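(* Let $d\ge 2$, $k\ge1$, and let $T\subset\mathbb R^d$ be a (nondegenerate) simplex. Then the degrees of freedom $$(t_{F,i}^{\intercal}\tau n, q)_F,\quad q\in\mathbb P_k(F),\ i=1,\dots,d-1,\ F\in\mathcal F(T),$$ $$(\tau,q)_T,\quad q\in\mathbb P_k(T;\mathbb S\cap\mathbb T),$$ are unisolvent for the space $\Sigma_k^+(T;\mathbb S\cap\mathbb T)$.
   Context: $\mathbb M=\mathbb R^{d\times d}$; $\mathbb S,\mathbb K,\mathbb T$ are its subspaces of symmetric, skew-symmetric and traceless matrices. $\mathbb P_m(D)$ is the space of polynomials on $D$ of total degree at most $m$, and $\mathbb P_m(D;\mathbb X)=\mathbb P_m(D)\otimes\mathbb X$. $(\cdot,\cdot)_D$ is the $L^2(D)$ inner product (Frobenius for matrices). $\mathcal F(T)$ is the set of facets of $T$, $n$ is the outward unit normal on $\partial T$. For a facet $F$ with unit normal $n_F$, $\Pi_F w:=(I-n_Fn_F^{\intercal})w|_F$, and $\{t_{F,i}\}_{i=1}^{d-1}$ is a fixed orthonormal basis of the tangent space of $F$. For $m\ge1$: $\mathbb B_m^{tn}(T;\mathbb T):=\{\tau\in\mathbb P_m(T;\mathbb T):\Pi_F(\tau n)=0\ \forall F\in\mathcal F(T)\}$. Set $\Sigma_k^+(T;\mathbb T):=\mathbb P_k(T;\mathbb T)+\mathbb B_{k+1}^{tn}(T;\mathbb T)$, and for $k\ge1$ $$\Sigma_k^+(T;\mathbb S\cap\mathbb T):=\{\tau\in\Sigma_k^+(T;\mathbb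 T):(\tau,q)_T=0\ \ \forall q\in\mathbb P_k(T;\mathbb K)\}$$ (functions in this space are in general not pointwise symmetric). Unisolvent means: the number of degrees of freedom (with $q$ running through bases of the indicated test spaces) equals the dimension of the space, and an element of the space for which all degrees of freedom vanish is zero. *)

theory Defs
  imports "HOL-Analysis.Analysis" "HOL-Library.Function_Algebras"
begin

text \<open>Real-valued and matrix-valued functions form a real vector space pointwise, so that the
  library's \<open>span\<close>, \<open>independent\<close> and \<open>dim\<close> apply to spaces of functions.\<close>

instantiation "fun" :: (type, real_vector) real_vector
begin

definition scaleR_fun :: "real \<Rightarrow> ('a \<Rightarrow> 'b) \<Rightarrow> 'a \<Rightarrow> 'b" where
  "scaleR_fun c f = (\<lambda>x. c *\<^sub>R f x)"

instance
  by standard (auto simp: scaleR_fun_def fun_eq_iff scaleR_add_right scaleR_add_left)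

end

definition sym_mats :: "(real^'n^'n) set" where
  "sym_mats = {A. transpose A = A}"

definition skew_mats :: "(real^'n^'n) set" where
  "skew_mats = {A. transpose A = - A}"

definition traceless_mats :: "(real^'n^'n) set" where
  "traceless_mats = {A. trace A = 0}"

text \<open>A function on \<open>D\<close> is represented by its extension by zero to the whole space; two polynomials
  that agree on \<open>D\<close> thus give the same element. The exponents \<open>\<alpha>\<close> are multi-indices.\<close>

definition polys :: "nat \<Rightarrow> (real^'n) set \<Rightarrow> (real^'n \<Rightarrow> real) set" where
  "polys m D = {p. \<exists>c :: ('n \<Rightarrow> nat) \<Rightarrow> real. \<forall>x.
     p x = (if x \<in> D then \<Sum>\<alpha> | (\<Sum>j\<in>UNIV. \<alpha> j) \<le> m. c \<alpha> * (\<Prod>j\<in>UNIV. (x $ j) ^ \<alpha> j) else 0)}"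

text \<open>The tensor product of \<open>polys m D\<close> with \<open>X\<close>, as the span of the elementary tensors.\<close>

definition mat_polys ::
    "nat \<Rightarrow> (real^'n) set \<Rightarrow> (real^'n^'n) set \<Rightarrow> (real^'n \<Rightarrow> real^'n^'n) set" where
  "mat_polys m D X = span {(\<lambda>x. p x *\<^sub>R A) | p A. p \<in> polys m D \<and> A \<in> X}"

text \<open>The inner product of \<open>L\<^sup>2(D)\<close> with respect to \<open>M\<close>. On matrices, \<open>\<bullet>\<close> is the Frobenius inner
  product; on real numbers it is multiplication.\<close>

definition L2_inner ::
    "'a measure \<Rightarrow> 'a set \<Rightarrow> ('a \<Rightarrow> 'b::real_inner) \<Rightarrow> ('a \<Rightarrow> 'b) \<Rightarrow> real" where
  "L2_inner M D f g = (LINT x:D|M. f x \<bullet> g x)"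

definition tangent_space :: "(real^'n) set \<Rightarrow> (real^'n) set" where
  "tangent_space F = {x - y | x y. x \<in> affine hull F \<and> y \<in> affine hull F}"

definition orthonormal_tangent_basis :: "(real^'n) set \<Rightarrow> (nat \<Rightarrow> real^'n) \<Rightarrow> bool" where
  "orthonormal_tangent_basis F u \<longleftrightarrow>
     (\<forall>i\<in>{1..CARD('n) - 1}. \<forall>j\<in>{1..CARD('n) - 1}. u i \<bullet> u j = (if i = j then 1 else 0)) \<and>
     span (u ` {1..CARD('n) - 1}) = tangent_space F"

text \<open>The surface measure on the hyperplane spanned by a facet \<open>F\<close> is the image of the
  \<open>(d-1)\<close>-dimensional Lebesgue measure under an isometric affine parametrization. It does not depend
  on the chosen base point and orthonormal basis.\<close>

definition surface_measure :: "(real^'n) set \<Rightarrow> (real^'n) measure" where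
  "surface_measure F =
     (let a = (SOME a. a \<in> F); u = (SOME u. orthonormal_tangent_basis F u)
      in distr (Pi\<^sub>M {1..CARD('n) - 1} (\<lambda>_. lborel :: real measure)) borel
           (\<lambda>y. a + (\<Sum>i = 1..CARD('n) - 1. y i *\<^sub>R u i)))"

definition outward_normal :: "(real^'n) set \<Rightarrow> (real^'n) set \<Rightarrow> real^'n" where
  "outward_normal T F = (THE \<nu>. norm \<nu> = 1 \<and> (\<forall>v\<in>tangent_space F. \<nu> \<bullet> v = 0) \<and>
     (\<forall>x\<in>T. \<forall>y\<in>F. \<nu> \<bullet> (x - y) \<le> 0))"

text \<open>The projection \<open>I - \<nu> \<nu>\<^sup>T\<close>; it is unchanged when \<open>\<nu>\<close> is replaced by \<open>-\<nu>\<close>.\<close>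

definition tangential_proj :: "real^'n \<Rightarrow> real^'n^'n" where
  "tangential_proj \<nu> = mat 1 - (\<chi> i j. \<nu> $ i * \<nu> $ j)"

definition bubble_tn :: "nat \<Rightarrow> (real^'n) set \<Rightarrow> (real^'n \<Rightarrow> real^'n^'n) set" where
  "bubble_tn m T = {\<tau> \<in> mat_polys m T traceless_mats. \<forall>F. F facet_of T \<longrightarrow>
     (\<forall>x\<in>F. tangential_proj (outward_normal T F) *v (\<tau> x *v outward_normal T F) = 0)}"

definition Sigma_plus :: "nat \<Rightarrow> (real^'n) set \<Rightarrow> (real^'n \<Rightarrow> real^'n^'n) set" where
  "Sigma_plus k T = {\<sigma> + \<beta> | \<sigma> \<beta>. \<sigma> \<in> mat_polys k T traceless_mats \<and> \<beta> \<in> bubble_tn (k + 1) T}"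

definition Sigma_plus_sym :: "nat \<Rightarrow> (real^'n) set \<Rightarrow> (real^'n \<Rightarrow> real^'n^'n) set" where
  "Sigma_plus_sym k T =
     {\<tau> \<in> Sigma_plus k T. \<forall>q \<in> mat_polys k T skew_mats. L2_inner lborel T \<tau> q = 0}"

definition is_basis :: "'v::real_vector set \<Rightarrow> 'v set \<Rightarrow> bool" where
  "is_basis V B \<longleftrightarrow> independent B \<and> span B = V"

text \<open>\<open>I\<close> indexes the degrees of freedom \<open>l i\<close>.\<close>

definition unisolvent ::
    "'v::real_vector set \<Rightarrow> 'i set \<Rightarrow> ('i \<Rightarrow> 'v \<Rightarrow> real) \<Rightarrow> bool" where
  "unisolvent V I l \<longleftrightarrow>
     finite I \<and> card I = dim V \<and> (\<forall>\<tau>\<in>V. (\<forall>i\<in>I. l i \<tau> = 0) \<longrightarrow> \<tau> = 0)"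

datatype 'n dof =
    Facet_dof "(real^'n) set" nat "real^'n \<Rightarrow> real"
  | Interior_dof "real^'n \<Rightarrow> real^'n^'n"

definition dof_index ::
    "(real^'n) set \<Rightarrow> ((real^'n) set \<Rightarrow> (real^'n \<Rightarrow> real) set) \<Rightarrow>
      (real^'n \<Rightarrow> real^'n^'n) set \<Rightarrow> 'n dof set" where
  "dof_index T BF BT =
     {Facet_dof F i q | F i q. F facet_of T \<and> i \<in> {1..CARD('n) - 1} \<and> q \<in> BF F} \<union>
     {Interior_dof q | q. q \<in> BT}"

fun dof_val ::
    "(real^'n) set \<Rightarrow> ((real^'n) set \<Rightarrow> nat \<Rightarrow> real^'n) \<Rightarrow>
      'n dof \<Rightarrow> (real^'n \<Rightarrow> real^'n^'n) \<Rightarrow> real" where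
  "dof_val T t (Facet_dof F i q) \<tau> =
     L2_inner (surface_measure F) F (\<lambda>x. t F i \<bullet> (\<tau> x *v outward_normal T F)) q"
| "dof_val T t (Interior_dof q) \<tau> = L2_inner lborel T \<tau> q"

end

theory Submission
  imports Defs
begin

text \<open>For a facet \<open>F\<close> with unit normal \<open>n\<close> and tangent basis \<open>t\<^sub>1, \<dots>, t\<^sub>d\<^sub>-\<^sub>1\<close>, write
  \<open>tn F i A = t\<^sub>i \<bullet> (A n)\<close>. Everything rests on the fact that these numbers are coordinates for
  traceless matrices. If they all vanish, every normal is an eigenvector of \<open>A\<close>; the normals of a
  simplex satisfy a single linear relation, in which every coefficient is positive, so all the
  eigenvalues agree and \<open>A\<close> is a multiple of the identity, hence zero
  (\<open>traceless_eq_0_if_tn_eq_0\<close>). Conversely there are traceless matrices \<open>\<phi>\<^bsub>F,i\<^esub>\<close> with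
  \<open>tn F' j \<phi>\<^bsub>F,i\<^esub> = \<delta>\<close> (\<open>ex_dual_mat\<close>), so \<open>A = \<Sum> tn F i A \<cdot> \<phi>\<^bsub>F,i\<^esub>\<close>. A traceless polynomial field is
  thus the same as a family of scalar polynomials, and it is a bubble exactly if the polynomial
  belonging to \<open>(F, i)\<close> vanishes on \<open>F\<close>, that is, if it is divisible by the distance
  \<open>height F\<close> to the hyperplane of \<open>F\<close>.

  Injectivity (\<open>Sigma_plus_sym_eq_0\<close>). Let all degrees of freedom of \<open>\<tau>\<close> vanish. On \<open>F\<close> the function
  \<open>tn F i \<circ> \<tau>\<close> has degree at most \<open>k\<close>, since bubbles do not contribute, so it vanishes there and
  \<open>tn F i \<circ> \<tau> = height F \<cdot> r\<close> with \<open>r\<close> of degree at most \<open>k\<close>. As \<open>\<tau>\<close> is orthogonal to the symmetric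
  traceless and to the skew fields of degree \<open>k\<close>, it is orthogonal to all traceless ones; testing with
  \<open>r t\<^sub>i n\<^sup>T\<close> gives \<open>\<integral> height F \<cdot> r\<^sup>2 = 0\<close>, so \<open>r = 0\<close>.

  Counting. Instead of comparing dimensions, the functionals are shown to be linearly independent on
  the space, which together with injectivity gives equality of the numbers (\<open>unisolventI\<close>). For this,
  some degrees of freedom are prescribed while the others vanish. The bubble \<open>\<Sum> height F \<cdot> p\<^bsub>F,i\<^esub> \<cdot> \<phi>\<^bsub>F,i\<^esub>\<close>
  can be given any moments against traceless fields of degree \<open>k\<close>, because
  \<open>(p, r) \<mapsto> \<integral> height F \<cdot> p r\<close> is an inner product on polynomials (\<open>ex_bubble_with_moments\<close>). Such
  bubbles prescribe the interior moments, and they correct a field \<open>P \<cdot> \<phi>\<^bsub>F,i\<^esub>\<close> with given facet trace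
  to one with vanishing moments.\<close>

section \<open>Matrices\<close>

definition dyad :: "real^'n \<Rightarrow> real^'n \<Rightarrow> real^'n^'n" where
  "dyad a b = (\<chi> i j. a $ i * b $ j)"

lemma dyad_mult_vec: "dyad a b *v x = (b \<bullet> x) *\<^sub>R a"
  by (simp add: vec_eq_iff dyad_def matrix_vector_mult_def inner_vec_def sum_distrib_left
      sum_distrib_right mult_ac)

lemma trace_dyad: "trace (dyad a b) = a \<bullet> b"
  by (simp add: trace_def dyad_def inner_vec_def)

lemma inner_dyad: "A \<bullet> dyad a b = a \<bullet> (A *v b)"
  by (simp add: dyad_def inner_vec_def matrix_vector_mult_def sum_distrib_left mult_ac)

lemma trace_scaleR: "trace (c *\<^sub>R A) = c * trace (A :: real^'n^'n)"
  by (simp add: trace_def sum_distrib_left)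

lemma trace_sum: "trace (sum f I) = (\<Sum>i\<in>I. trace (f i :: real^'n^'n))"
  by (induction I rule: infinite_finite_induct) (auto simp: trace_add trace_0[simplified mat_0])

lemma matrix_vector_mult_sum_left:
  "sum f I *v x = (\<Sum>i\<in>I. (f i :: real^'n^'n) *v x)"
  by (induction I rule: infinite_finite_induct) (auto simp: matrix_vector_mult_add_rdistrib)

lemma matrix_vector_mult_sum:
  "(A :: real^'n^'n) *v sum f I = (\<Sum>i\<in>I. A *v f i)"
  by (induction I rule: infinite_finite_induct) (auto simp: matrix_vector_right_distrib)

lemma tangential_proj_mult:
  "tangential_proj \<nu> *v w = w - (\<nu> \<bullet> w) *\<^sub>R \<nu>"
  using dyad_mult_vec[of \<nu> \<nu> w]
  by (simp add: tangential_proj_def dyad_def matrix_vector_mult_diff_rdistrib)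

section \<open>Barycentric coordinates of a simplex\<close>

text \<open>The vertices seen from one of them are linearly independent, so a linear functional may be
  prescribed on them; \<open>g u\<close> is its representing vector, the gradient of the barycentric coordinate
  of the vertex \<open>u\<close>.\<close>

lemma simplex_barycentric_gradients:
  fixes C :: "(real^'n) set"
  assumes "\<not> affine_dependent C"
  shows "\<exists>g b. \<forall>u\<in>C. \<forall>v\<in>C. g u \<bullet> v + b u = (if u = v then 1 else (0::real))"
proof -
  have "\<exists>g b. \<forall>v\<in>C. g \<bullet> v + b = (if u = v then 1 else (0::real))" if u: "u \<in> C" for u
  proof (cases "C = {u}")
    case True
    then show ?thesis by (intro exI[of _ 0] exI[of _ 1]) auto
  next
    case False
    then obtain w where w: "w \<in> C" "w \<noteq> u" using u by blast
    define f where "f x = (if x = - w + u then 1 else (0::real))" for x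
    have "independent ((+) (- w) ` (C - {w}))"
      using assms w affine_dependent_iff_dependent2[OF w(1)] by auto
    then obtain h where h: "linear h" "\<forall>x\<in>(+) (- w) ` (C - {w}). h x = f x"
      using linear_independent_extend by blast
    define g where "g = adjoint h 1"
    have g: "g \<bullet> x = h x" for x
      unfolding g_def using adjoint_works[OF h(1), of x 1] by (simp add: inner_commute)
    have "g \<bullet> v + - (g \<bullet> w) = (if u = v then 1 else 0)" if v: "v \<in> C" for v
    proof -
      have "g \<bullet> v + - (g \<bullet> w) = h (- w + v)"
        using h(1) by (simp add: g linear_diff)
      also have "\<dots> = (if u = v then 1 else 0)"
      proof (cases "v = w")
        case True
        then show ?thesis using w h(1) by (simp add: linear_0)
      next
        case False
        then have "h (- w + v) = f (- w + v)" using h(2) v by blast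
        then show ?thesis by (auto simp: f_def)
      qed
      finally show ?thesis .
    qed
    then show ?thesis by blast
  qed
  then show ?thesis by metis
qed

locale barycentric_simplex =
  fixes T :: "(real^'n) set" and C :: "(real^'n) set"
    and g :: "real^'n \<Rightarrow> real^'n" and b :: "real^'n \<Rightarrow> real"
  assumes indep: "\<not> affine_dependent C"
    and card_C: "card C = CARD('n) + 1"
    and dim_ge_2: "CARD('n) \<ge> 2"
    and T_eq: "T = convex hull C"
    and dual: "\<And>u v. u \<in> C \<Longrightarrow> v \<in> C \<Longrightarrow> g u \<bullet> v + b u = (if u = v then 1 else 0)"
begin

definition bary :: "real^'n \<Rightarrow> real^'n \<Rightarrow> real" where
  "bary u x = g u \<bullet> x + b u"

lemma finite_C: "finite C"
  using card_C card.infinite by fastforce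

lemma affine_hull_C: "affine hull C = UNIV"
  using affine_independent_span_eq[OF indep] card_C by simp

lemma bary_vertex: "u \<in> C \<Longrightarrow> v \<in> C \<Longrightarrow> bary u v = (if u = v then 1 else 0)"
  using dual by (simp add: bary_def)

lemma bary_combination:
  assumes "u \<in> C" "sum \<mu> C = 1"
  shows "bary u (\<Sum>v\<in>C. \<mu> v *\<^sub>R v) = \<mu> u"
proof -
  have "bary u (\<Sum>v\<in>C. \<mu> v *\<^sub>R v) = (\<Sum>v\<in>C. \<mu> v * (g u \<bullet> v)) + (\<Sum>v\<in>C. \<mu> v) * b u"
    using assms by (simp add: bary_def inner_sum_right)
  also have "\<dots> = (\<Sum>v\<in>C. \<mu> v * bary u v)"
    by (simp add: bary_def sum_distrib_right sum.distrib distrib_left)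
  also have "\<dots> = (\<Sum>v\<in>C. if v = u then \<mu> u else 0)"
    by (rule sum.cong) (use assms bary_vertex in auto)
  also have "\<dots> = \<mu> u"
    using assms finite_C by simp
  finally show ?thesis .
qed

lemma bary_representation: "(\<Sum>u\<in>C. bary u x) = 1" "(\<Sum>u\<in>C. bary u x *\<^sub>R u) = x"
proof -
  have "x \<in> affine hull C" by (simp add: affine_hull_C)
  then obtain \<mu> where \<mu>: "sum \<mu> C = 1" "(\<Sum>v\<in>C. \<mu> v *\<^sub>R v) = x"
    unfolding affine_hull_finite[OF finite_C] by blast
  then have "bary u x = \<mu> u" if "u \<in> C" for u
    using bary_combination[OF that \<mu>(1)] by simp
  then show "(\<Sum>u\<in>C. bary u x) = 1" "(\<Sum>u\<in>C. bary u x *\<^sub>R u) = x"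
    using \<mu> by auto
qed

lemma sum_gradients: "(\<Sum>u\<in>C. g u) = 0"
proof -
  have "(\<Sum>u\<in>C. g u) \<bullet> x = (\<Sum>u\<in>C. bary u x) - (\<Sum>u\<in>C. bary u 0)" for x
    by (simp add: bary_def inner_sum_left sum.distrib)
  then have "(\<Sum>u\<in>C. g u) \<bullet> x = 0" for x
    by (simp add: bary_representation)
  then show ?thesis using inner_eq_zero_iff by blast
qed

text \<open>The barycentric coordinates reproduce the identity map, whose linear part is this expansion; its
  transpose is \<open>gradient_expansion_dual\<close>.\<close>

lemma gradient_expansion: "(\<Sum>u\<in>C. (g u \<bullet> w) *\<^sub>R u) = w"
proof -
  have "(\<Sum>u\<in>C. (g u \<bullet> w) *\<^sub>R u) = (\<Sum>u\<in>C. bary u w *\<^sub>R u) - (\<Sum>u\<in>C. bary u 0 *\<^sub>R u)"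
    by (simp add: bary_def scaleR_left_distrib sum.distrib)
  then show ?thesis by (simp add: bary_representation)
qed

lemma gradient_expansion_dual: "(\<Sum>u\<in>C. (w \<bullet> u) *\<^sub>R g u) = w"
proof -
  have "(\<Sum>u\<in>C. (w \<bullet> u) *\<^sub>R g u) \<bullet> x = w \<bullet> x" for x
  proof -
    have "(\<Sum>u\<in>C. (w \<bullet> u) *\<^sub>R g u) \<bullet> x = w \<bullet> (\<Sum>u\<in>C. (g u \<bullet> x) *\<^sub>R u)"
      by (simp add: inner_sum_left inner_sum_right mult.commute)
    then show ?thesis by (simp add: gradient_expansion)
  qed
  then show ?thesis by (metis vector_eq_rdot)
qed

lemma gradient_vertex_diff:
  assumes "u \<in> C" "v \<in> C" "w \<in> C"
  shows "g u \<bullet> (v - w) = (if u = v then 1 else 0) - (if u = w then 1 else 0)"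
  using dual[OF assms(1,2)] dual[OF assms(1,3)] by (simp add: inner_diff_right)

lemma ex_other_vertex: "\<exists>v\<in>C. v \<noteq> u"
proof (rule ccontr)
  assume "\<not> ?thesis"
  then have "C \<subseteq> {u}" by auto
  then have "card C \<le> 1" using card_mono[of "{u}" C] by simp
  then show False using card_C dim_ge_2 by linarith
qed

lemma gradient_nonzero: assumes "u \<in> C" shows "g u \<noteq> 0"
proof -
  obtain v where "v \<in> C" "v \<noteq> u" using ex_other_vertex by blast
  then have "g u \<bullet> (u - v) = 1" using gradient_vertex_diff[of u u v] assms by auto
  then show ?thesis by auto
qed

lemma mem_simplex_iff: "x \<in> T \<longleftrightarrow> (\<forall>u\<in>C. bary u x \<ge> 0)"
proof
  assume "x \<in> T"
  then obtain \<mu> where \<mu>: "\<forall>u\<in>C. 0 \<le> \<mu> u" "sum \<mu> C = 1" "(\<Sum>v\<in>C. \<mu> v *\<^sub>R v) = x"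
    unfolding T_eq convex_hull_finite[OF finite_C] by blast
  then show "\<forall>u\<in>C. bary u x \<ge> 0"
    using bary_combination[OF _ \<mu>(2)] by auto
next
  assume "\<forall>u\<in>C. bary u x \<ge> 0"
  then show "x \<in> T"
    unfolding T_eq convex_hull_finite[OF finite_C]
    using bary_representation by (intro CollectI exI[of _ "\<lambda>u. bary u x"]) auto
qed

lemma facet_iff: "F facet_of T \<longleftrightarrow> (\<exists>u\<in>C. F = convex hull (C - {u}))"
  unfolding T_eq facet_of_convex_hull_affine_independent_alt[OF indep]
  using card_C dim_ge_2 by auto

lemma affine_hull_facet:
  assumes "u \<in> C" shows "affine hull (convex hull (C - {u})) = {x. bary u x = 0}"
proof -
  have "x \<in> affine hull (C - {u}) \<longleftrightarrow> bary u x = 0" for x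
  proof
    assume "x \<in> affine hull (C - {u})"
    moreover have "affine hull (C - {u}) \<subseteq> {x. g u \<bullet> x = - b u}"
    proof (rule hull_minimal)
      show "C - {u} \<subseteq> {x. g u \<bullet> x = - b u}"
      proof
        fix v assume "v \<in> C - {u}"
        then show "v \<in> {x. g u \<bullet> x = - b u}" using dual[OF assms, of v] by auto
      qed
    qed (rule affine_hyperplane)
    ultimately show "bary u x = 0" by (auto simp: bary_def)
  next
    assume 0: "bary u x = 0"
    have "(\<Sum>v\<in>C-{u}. bary v x) = 1" "(\<Sum>v\<in>C-{u}. bary v x *\<^sub>R v) = x"
      using bary_representation[of x] 0 assms finite_C by (simp_all add: sum.remove)
    then show "x \<in> affine hull (C - {u})"
      using finite_C by (subst affine_hull_finite) auto
  qed
  then show ?thesis by auto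
qed

lemma mem_facet_iff:
  assumes "u \<in> C" shows "x \<in> convex hull (C - {u}) \<longleftrightarrow> x \<in> T \<and> bary u x = 0"
proof
  assume x: "x \<in> convex hull (C - {u})"
  have "x \<in> T" using x hull_mono[of "C - {u}" C convex] T_eq by auto
  moreover have "bary u x = 0"
    using affine_hull_facet[OF assms] hull_inc[OF x, of affine] by simp
  ultimately show "x \<in> T \<and> bary u x = 0" by simp
next
  assume x: "x \<in> T \<and> bary u x = 0"
  have "(\<Sum>v\<in>C-{u}. bary v x) = 1" "(\<Sum>v\<in>C-{u}. bary v x *\<^sub>R v) = x"
    using bary_representation[of x] x assms finite_C by (simp_all add: sum.remove)
  moreover have "\<forall>v\<in>C. 0 \<le> bary v x" using x mem_simplex_iff by blast
  ultimately show "x \<in> convex hull (C - {u})"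
    using finite_C by (subst convex_hull_finite) auto
qed

lemma tangent_space_facet:
  assumes "u \<in> C" shows "tangent_space (convex hull (C - {u})) = {w. g u \<bullet> w = 0}"
proof -
  obtain v where v: "v \<in> C" "v \<noteq> u" using ex_other_vertex by blast
  have "g u \<bullet> (x - y) = bary u x - bary u y" for x y
    by (simp add: bary_def inner_diff_right)
  moreover have "\<exists>x y. w = x - y \<and> bary u x = 0 \<and> bary u y = 0" if "g u \<bullet> w = 0" for w
    using bary_vertex[OF assms v(1)] v that
    by (intro exI[of _ "v + w"] exI[of _ v]) (auto simp: bary_def inner_add_right)
  ultimately show ?thesis
    unfolding tangent_space_def affine_hull_facet[OF assms] by auto
qed

lemma outward_normal_facet:
  assumes u: "u \<in> C"
  shows "outward_normal T (convex hull (C - {u})) = - (1 / norm (g u)) *\<^sub>R g u"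
  unfolding outward_normal_def tangent_space_facet[OF u]
proof (rule the_equality, goal_cases)
  case 1
  have "g u \<bullet> (x - y) \<ge> 0" if "x \<in> T" "y \<in> convex hull (C - {u})" for x y
  proof -
    have "bary u x \<ge> 0" "bary u y = 0" using that mem_simplex_iff mem_facet_iff u by auto
    then show ?thesis by (simp add: bary_def inner_diff_right)
  qed
  then show ?case using gradient_nonzero[OF u] by (auto simp: field_simps)
next
  case (2 \<nu>)
  define c where "c = (\<nu> \<bullet> g u) / (g u \<bullet> g u)"
  have "g u \<bullet> (\<nu> - c *\<^sub>R g u) = 0"
    using gradient_nonzero[OF u] by (simp add: c_def inner_diff_right inner_commute)
  then have "\<nu> \<bullet> (\<nu> - c *\<^sub>R g u) = 0" using 2 by blast
  then have "(\<nu> - c *\<^sub>R g u) \<bullet> (\<nu> - c *\<^sub>R g u) = 0"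
    using \<open>g u \<bullet> (\<nu> - c *\<^sub>R g u) = 0\<close> by (simp add: inner_diff_left)
  then have \<nu>: "\<nu> = c *\<^sub>R g u" by simp
  obtain v where v: "v \<in> C" "v \<noteq> u" using ex_other_vertex by blast
  have "u \<in> T" "v \<in> convex hull (C - {u})" using u v T_eq by (auto intro: hull_inc)
  then have "\<nu> \<bullet> (u - v) \<le> 0" using 2 by blast
  moreover have "g u \<bullet> (u - v) = 1" using gradient_vertex_diff[OF u u v(1)] v by simp
  ultimately have "c \<le> 0" using \<nu> by simp
  moreover have "\<bar>c\<bar> * norm (g u) = 1" using 2 \<nu> by (metis norm_scaleR)
  ultimately have "c = - (1 / norm (g u))"
    using gradient_nonzero[OF u] by (simp add: field_simps abs_if split: if_splits)
  then show ?case using \<nu> by simp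
qed

text \<open>The gradients satisfy the relation \<open>\<Sum> g u = 0\<close> and, up to multiples, no other. Applying \<open>A\<close> to
  it gives \<open>\<Sum> c u \<cdot> g u = 0\<close>, so all eigenvalues \<open>c u\<close> coincide; as the gradients span the whole
  space, \<open>A\<close> is a multiple of the identity.\<close>

lemma traceless_normal_normal_zero:
  assumes "trace A = 0"
    and eig: "\<And>u. u \<in> C \<Longrightarrow> \<exists>c. A *v g u = c *\<^sub>R g u"
  shows "A = 0"
proof -
  obtain c where c: "\<And>u. u \<in> C \<Longrightarrow> A *v g u = c u *\<^sub>R g u" using eig by metis
  have sum0: "(\<Sum>u\<in>C. c u *\<^sub>R g u) = 0"
  proof -
    have "(\<Sum>u\<in>C. c u *\<^sub>R g u) = A *v (\<Sum>u\<in>C. g u)"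
      by (simp add: matrix_vector_mult_sum c)
    then show ?thesis by (simp add: sum_gradients)
  qed
  have eq: "c u = c v" if "u \<in> C" "v \<in> C" for u v
  proof -
    have "0 = (\<Sum>z\<in>C. c z *\<^sub>R g z) \<bullet> (u - v)" by (simp add: sum0)
    also have "\<dots> = (\<Sum>z\<in>C. c z * ((if z = u then 1 else 0) - (if z = v then 1 else 0)))"
      by (auto simp: inner_sum_left gradient_vertex_diff that intro!: sum.cong)
    also have "\<dots> = c u - c v"
      using that finite_C by (simp add: right_diff_distrib sum_subtractf mult_delta_right)
    finally show ?thesis by simp
  qed
  obtain z where z: "z \<in> C" using ex_other_vertex by blast
  have "A *v w = c z *\<^sub>R w" for w
  proof -
    have "A *v w = A *v (\<Sum>u\<in>C. (w \<bullet> u) *\<^sub>R g u)" by (simp add: gradient_expansion_dual)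
    also have "\<dots> = c z *\<^sub>R (\<Sum>u\<in>C. (w \<bullet> u) *\<^sub>R g u)"
      using c eq[OF z]
      by (simp add: matrix_vector_mult_sum matrix_vector_mult_scaleR scaleR_sum_right mult.commute)
    finally show ?thesis by (simp add: gradient_expansion_dual)
  qed
  then have A: "A = c z *\<^sub>R mat 1"
    unfolding matrix_eq scaleR_matrix_vector_assoc[symmetric] matrix_vector_mul_lid by blast
  then have "c z * real CARD('n) = 0" using assms(1) trace_scaleR[of "c z" "mat 1 :: real^'n^'n"] by (simp add: trace_I)
  then show ?thesis using A by simp
qed

text \<open>With \<open>v\<close> as the origin, the edges \<open>u - v\<close> and the gradients \<open>g u\<close> with \<open>u \<noteq> v\<close> are dual bases.
  A combination of the matrices \<open>g u (u - v)\<^sup>T\<close> has each of these gradients as eigenvector, and the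
  eigenvalues can be chosen such that \<open>g v = - \<Sum> g u\<close> is mapped to \<open>s\<close>. Adding a multiple of the
  identity makes the trace vanish and changes the images by multiples of the gradients only.\<close>

lemma ex_traceless_with_normal_image:
  assumes v: "v \<in> C" and s: "g v \<bullet> s = 0"
  shows "\<exists>\<phi>. trace \<phi> = 0 \<and> (\<exists>\<alpha>. \<phi> *v g v = s + \<alpha> *\<^sub>R g v) \<and>
    (\<forall>u\<in>C. u \<noteq> v \<longrightarrow> (\<exists>\<alpha>. \<phi> *v g u = \<alpha> *\<^sub>R g u))"
proof -
  define \<psi> where "\<psi> = (\<Sum>u\<in>C. - (s \<bullet> (u - v)) *\<^sub>R dyad (g u) (u - v))"
  define \<alpha> where "\<alpha> = - trace \<psi> / real CARD('n)"
  have mult: "\<psi> *v w = (\<Sum>u\<in>C. - ((s \<bullet> (u - v)) * (w \<bullet> (u - v))) *\<^sub>R g u)" for w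
    unfolding \<psi>_def matrix_vector_mult_sum_left
    by (rule sum.cong) (simp_all only: scaleR_matrix_vector_assoc[symmetric] dyad_mult_vec
        scaleR_scaleR inner_commute[of w] mult_minus_left)
  have "\<psi> *v g v = (\<Sum>u\<in>C. (s \<bullet> (u - v)) *\<^sub>R g u)"
    unfolding mult
    by (rule sum.cong) (auto simp: gradient_vertex_diff v)
  also have "\<dots> = (\<Sum>u\<in>C. (s \<bullet> u) *\<^sub>R g u) - (s \<bullet> v) *\<^sub>R (\<Sum>u\<in>C. g u)"
    by (simp add: inner_diff_right scaleR_diff_left sum_subtractf scaleR_sum_right)
  finally have v1: "\<psi> *v g v = s"
    by (simp add: gradient_expansion_dual sum_gradients)
  have u1: "\<psi> *v g u = - (s \<bullet> (u - v)) *\<^sub>R g u" if u: "u \<in> C" "u \<noteq> v" for u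
  proof -
    have "\<psi> *v g u = (\<Sum>z\<in>C. if z = u then - (s \<bullet> (u - v)) *\<^sub>R g u else 0)"
      unfolding mult
      by (rule sum.cong) (use u v in \<open>auto simp: gradient_vertex_diff\<close>)
    then show ?thesis using u finite_C by simp
  qed
  define \<phi> where "\<phi> = \<psi> + \<alpha> *\<^sub>R mat 1"
  have \<phi>: "\<phi> *v w = \<psi> *v w + \<alpha> *\<^sub>R w" for w
    by (simp only: \<phi>_def matrix_vector_mult_add_rdistrib scaleR_matrix_vector_assoc[symmetric]
        matrix_vector_mul_lid)
  have "trace \<phi> = trace \<psi> + \<alpha> * real CARD('n)"
    by (simp add: \<phi>_def trace_add trace_scaleR trace_I)
  then have "trace \<phi> = 0"
    by (simp add: \<alpha>_def)
  moreover have "\<phi> *v g v = s + \<alpha> *\<^sub>R g v" by (simp add: \<phi> v1)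
  moreover have "\<phi> *v g u = (- (s \<bullet> (u - v)) + \<alpha>) *\<^sub>R g u" if "u \<in> C" "u \<noteq> v" for u
    using u1[OF that] by (simp only: \<phi> scaleR_left_distrib)
  ultimately show ?thesis
    by (intro exI[of _ \<phi>] conjI ballI impI) auto
qed

end

section \<open>Polynomials of bounded total degree\<close>

lemma sum_fun_apply: "(\<Sum>i\<in>I. f i) x = (\<Sum>i\<in>I. f i x)"
  by (induction I rule: infinite_finite_induct) auto

abbreviation monomial :: "('n::finite \<Rightarrow> nat) \<Rightarrow> real^'n \<Rightarrow> real" where
  "monomial \<alpha> x \<equiv> (\<Prod>j\<in>UNIV. (x $ j) ^ \<alpha> j)"

abbreviation (input) zero_ext :: "'a set \<Rightarrow> ('a \<Rightarrow> 'b::zero) \<Rightarrow> 'a \<Rightarrow> 'b" where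
  "zero_ext D f \<equiv> (\<lambda>x. if x \<in> D then f x else 0)"

lemma finite_multi_indices: "finite {\<alpha> :: 'n::finite \<Rightarrow> nat. (\<Sum>j\<in>UNIV. \<alpha> j) \<le> m}"
proof (rule finite_subset)
  show "{\<alpha> :: 'n \<Rightarrow> nat. (\<Sum>j\<in>UNIV. \<alpha> j) \<le> m} \<subseteq> Pi\<^sub>E UNIV (\<lambda>_. {..m})"
  proof
    fix \<alpha> :: "'n \<Rightarrow> nat" assume "\<alpha> \<in> {\<alpha>. (\<Sum>j\<in>UNIV. \<alpha> j) \<le> m}"
    then have "(\<Sum>j\<in>UNIV. \<alpha> j) \<le> m" by simp
    moreover have "\<alpha> j \<le> (\<Sum>j\<in>UNIV. \<alpha> j)" for j
      by (rule member_le_sum) auto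
    ultimately show "\<alpha> \<in> Pi\<^sub>E UNIV (\<lambda>_. {..m})"
      by (auto simp: PiE_UNIV_domain intro: le_trans)
  qed
  show "finite (Pi\<^sub>E (UNIV :: 'n set) (\<lambda>_. {..m}))" by (intro finite_PiE) auto
qed

text \<open>Elements of \<open>polys m D\<close> are extended by zero. Algebraic arguments need the polynomial itself on the
  whole space; this lemma passes from one to the other.\<close>

lemma polys_iff_extension:
  "p \<in> polys m D \<longleftrightarrow> (\<exists>P\<in>polys m UNIV. p = zero_ext D P)"
proof
  assume "p \<in> polys m D"
  then obtain c where c: "\<And>x. p x = (if x \<in> D then \<Sum>\<alpha> | (\<Sum>j\<in>UNIV. \<alpha> j) \<le> m. c \<alpha> * monomial \<alpha> x else 0)"
    unfolding polys_def by blast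
  show "\<exists>P\<in>polys m UNIV. p = zero_ext D P"
    by (rule bexI[of _ "\<lambda>x. \<Sum>\<alpha> | (\<Sum>j\<in>UNIV. \<alpha> j) \<le> m. c \<alpha> * monomial \<alpha> x"])
       (auto simp: fun_eq_iff c polys_def)
next
  assume "\<exists>P\<in>polys m UNIV. p = zero_ext D P"
  then show "p \<in> polys m D" by (auto simp: polys_def)
qed

lemma subspace_polys: "subspace (polys m D)"
proof (rule subspaceI)
  show "0 \<in> polys m D"
    unfolding polys_def by (intro CollectI exI[of _ "\<lambda>_. 0"]) simp
next
  fix p q assume "p \<in> polys m D" "q \<in> polys m D"
  then obtain c d where
    "\<And>x. p x = (if x \<in> D then \<Sum>\<alpha> | (\<Sum>j\<in>UNIV. \<alpha> j) \<le> m. c \<alpha> * monomial \<alpha> x else 0)"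
    "\<And>x. q x = (if x \<in> D then \<Sum>\<alpha> | (\<Sum>j\<in>UNIV. \<alpha> j) \<le> m. d \<alpha> * monomial \<alpha> x else 0)"
    unfolding polys_def by blast
  then show "p + q \<in> polys m D"
    unfolding polys_def
    by (intro CollectI exI[of _ "\<lambda>\<alpha>. c \<alpha> + d \<alpha>"]) (auto simp: sum.distrib distrib_right)
next
  fix r p assume "p \<in> polys m D"
  then obtain c where
    "\<And>x. p x = (if x \<in> D then \<Sum>\<alpha> | (\<Sum>j\<in>UNIV. \<alpha> j) \<le> m. c \<alpha> * monomial \<alpha> x else 0)"
    unfolding polys_def by blast
  then show "r *\<^sub>R p \<in> polys m D"
    unfolding polys_def
    by (intro CollectI exI[of _ "\<lambda>\<alpha>. r * c \<alpha>"]) (auto simp: scaleR_fun_def sum_distrib_left mult.assoc)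
qed

lemma polys_add: "p \<in> polys m D \<Longrightarrow> q \<in> polys m D \<Longrightarrow> (\<lambda>x. p x + q x) \<in> polys m D"
  using subspace_add[OF subspace_polys, of p m D q] by (simp add: plus_fun_def)

lemma polys_cmult: "p \<in> polys m D \<Longrightarrow> (\<lambda>x. r * p x) \<in> polys m D"
  using subspace_scale[OF subspace_polys, of p m D r] by (simp add: scaleR_fun_def)

lemma polys_zero: "(\<lambda>x. 0) \<in> polys m D"
  using subspace_0[OF subspace_polys] by (simp add: zero_fun_def)

lemma polys_sum: "(\<And>i. i \<in> I \<Longrightarrow> f i \<in> polys m D) \<Longrightarrow> (\<lambda>x. \<Sum>i\<in>I. f i x) \<in> polys m D"
  by (induction I rule: infinite_finite_induct) (auto intro: polys_add polys_zero)

lemma monomial_in_polys: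
  fixes \<alpha> :: "'a::finite \<Rightarrow> nat"
  assumes "(\<Sum>j\<in>UNIV. \<alpha> j) \<le> m" shows "zero_ext D (monomial \<alpha>) \<in> polys m D"
proof -
  have "(\<Sum>\<beta> | (\<Sum>j\<in>UNIV. \<beta> j) \<le> m. (if \<beta> = \<alpha> then 1 else 0) * monomial \<beta> x) = monomial \<alpha> x" for x :: "real^'a"
  proof -
    have "(\<Sum>\<beta> | (\<Sum>j\<in>UNIV. \<beta> j) \<le> m. (if \<beta> = \<alpha> then 1 else 0) * monomial \<beta> x)
        = (\<Sum>\<beta> | (\<Sum>j\<in>UNIV. \<beta> j) \<le> m. if \<beta> = \<alpha> then monomial \<beta> x else 0)"
      by (rule sum.cong) auto
    also have "\<dots> = monomial \<alpha> x"
      using sum.delta[OF finite_multi_indices[of m], of \<alpha> "\<lambda>\<beta>. monomial \<beta> x"] assms by simp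
    finally show ?thesis .
  qed
  then show ?thesis
    unfolding polys_def by (intro CollectI exI[of _ "\<lambda>\<beta>. if \<beta> = \<alpha> then 1 else 0"]) simp
qed

lemma polys_in_span:
  "polys m D \<subseteq> span ((\<lambda>\<alpha>. zero_ext D (monomial \<alpha>)) ` {\<alpha>. (\<Sum>j\<in>UNIV. \<alpha> j) \<le> m})"
proof
  fix p assume "p \<in> polys m D"
  then obtain c where
    "\<And>x. p x = (if x \<in> D then \<Sum>\<alpha> | (\<Sum>j\<in>UNIV. \<alpha> j) \<le> m. c \<alpha> * monomial \<alpha> x else 0)"
    unfolding polys_def by blast
  then have "p = (\<Sum>\<alpha> | (\<Sum>j\<in>UNIV. \<alpha> j) \<le> m. c \<alpha> *\<^sub>R zero_ext D (monomial \<alpha>))"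
    by (auto simp: fun_eq_iff sum_fun_apply scaleR_fun_def)
  also have "\<dots> \<in> span ((\<lambda>\<alpha>. zero_ext D (monomial \<alpha>)) ` {\<alpha>. (\<Sum>j\<in>UNIV. \<alpha> j) \<le> m})"
    by (intro span_sum span_scale span_base) auto
  finally show "p \<in> span ((\<lambda>\<alpha>. zero_ext D (monomial \<alpha>)) ` {\<alpha>. (\<Sum>j\<in>UNIV. \<alpha> j) \<le> m})" .
qed

lemma polys_finite_span: "\<exists>S. finite S \<and> polys m D = span S"
proof (intro exI conjI antisym)
  let ?S = "(\<lambda>\<alpha>. zero_ext D (monomial \<alpha>)) ` {\<alpha>. (\<Sum>j\<in>UNIV. \<alpha> j) \<le> m}"
  show "finite ?S" using finite_multi_indices by blast
  show "polys m D \<subseteq> span ?S" by (rule polys_in_span)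
  show "span ?S \<subseteq> polys m D"
    by (rule span_minimal) (auto intro: monomial_in_polys subspace_polys)
qed

lemma monomial_Suc: "monomial (\<alpha>(i := Suc (\<alpha> i))) x = x $ i * monomial \<alpha> x"
proof -
  have "monomial (\<alpha>(i := Suc (\<alpha> i))) x
      = (x $ i) ^ Suc (\<alpha> i) * (\<Prod>j\<in>UNIV-{i}. (x $ j) ^ \<alpha> j)"
    by (subst prod.remove[of UNIV i]) auto
  also have "\<dots> = x $ i * monomial \<alpha> x"
    using prod.remove[of UNIV i "\<lambda>j. (x $ j) ^ \<alpha> j"] by (simp add: mult.assoc)
  finally show ?thesis .
qed

lemma multi_index_size_Suc:
  "(\<Sum>j\<in>UNIV. (\<alpha>(i := Suc (\<alpha> i))) j) = Suc (\<Sum>j\<in>(UNIV::'n::finite set). \<alpha> j)"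
  by (subst (1 2) sum.remove[of UNIV i]) auto

text \<open>Every monomial arises from the constant 1 by multiplications with coordinates. This replaces
  computations with multi-indices by an induction that keeps track of the degree.\<close>

lemma polys_induct [consumes 1, case_names one times_coord mono zero add scale]:
  assumes "p \<in> polys m UNIV"
    and one: "Q 0 (\<lambda>_. 1)"
    and times_coord: "\<And>m p i. p \<in> polys m UNIV \<Longrightarrow> Q m p \<Longrightarrow> Q (Suc m) (\<lambda>x. x $ i * p x)"
    and mono: "\<And>m p. p \<in> polys m UNIV \<Longrightarrow> Q m p \<Longrightarrow> Q (Suc m) p"
    and zero: "\<And>m. Q m (\<lambda>_. 0)"
    and add: "\<And>m p q. Q m p \<Longrightarrow> Q m q \<Longrightarrow> Q m (\<lambda>x. p x + q x)"
    and scale: "\<And>m p r. Q m p \<Longrightarrow> Q m (\<lambda>x. r * p x)"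
  shows "Q m p"
proof -
  have monomial: "Q s (monomial \<alpha>)" if "(\<Sum>j\<in>UNIV. \<alpha> j) = s" for \<alpha> s
    using that
  proof (induction s arbitrary: \<alpha>)
    case 0
    then have "\<alpha> j = 0" for j by simp
    then show ?case using one by simp
  next
    case (Suc s)
    then obtain i where "\<alpha> i \<noteq> 0" by (metis sum.neutral nat.distinct(1))
    then obtain a where a: "\<alpha> i = Suc a" using not0_implies_Suc by blast
    define \<beta> where "\<beta> = \<alpha>(i := a)"
    have \<alpha>: "\<alpha> = \<beta>(i := Suc (\<beta> i))" by (simp add: \<beta>_def a[symmetric])
    have size: "(\<Sum>j\<in>UNIV. \<beta> j) = s"
      using Suc.prems multi_index_size_Suc[of \<beta> i] \<alpha> by simp
    have "Q (Suc s) (\<lambda>x. x $ i * monomial \<beta> x)"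
      using times_coord[OF _ Suc.IH[OF size]] monomial_in_polys[of \<beta> s UNIV] size by simp
    then show ?case by (subst \<alpha>) (simp only: monomial_Suc)
  qed
  have monomial': "Q m (monomial \<alpha>)" if "(\<Sum>j\<in>UNIV. \<alpha> j) \<le> m" for \<alpha>
  proof -
    have "Q n (monomial \<alpha>)" if "(\<Sum>j\<in>UNIV. \<alpha> j) \<le> n" for n
      using that
    proof (induction n rule: dec_induct)
      case base
      then show ?case using monomial by simp
    next
      case (step n)
      then show ?case using mono[of "monomial \<alpha>" n] monomial_in_polys[of \<alpha> n UNIV] by simp
    qed
    then show ?thesis using that by blast
  qed
  obtain c where c: "\<And>x. p x = (\<Sum>\<alpha> | (\<Sum>j\<in>UNIV. \<alpha> j) \<le> m. c \<alpha> * monomial \<alpha> x)"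
    using assms(1) unfolding polys_def by auto
  have "Q m (\<lambda>x. \<Sum>\<alpha>\<in>A. c \<alpha> * monomial \<alpha> x)" if "A \<subseteq> {\<alpha>. (\<Sum>j\<in>UNIV. \<alpha> j) \<le> m}" for A
    using finite_subset[OF that finite_multi_indices] that
  proof (induction A rule: finite_induct)
    case empty
    then show ?case using zero by simp
  next
    case (insert \<alpha> A)
    then show ?case using add[OF scale[OF monomial']] by simp
  qed
  moreover have "p = (\<lambda>x. \<Sum>\<alpha> | (\<Sum>j\<in>UNIV. \<alpha> j) \<le> m. c \<alpha> * monomial \<alpha> x)"
    using c by (rule ext)
  ultimately show ?thesis by simp
qed

lemma polys_times_coord:
  assumes "p \<in> polys m UNIV" shows "(\<lambda>x. x $ i * p x) \<in> polys (Suc m) UNIV"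
proof -
  obtain c where c: "\<And>x. p x = (\<Sum>\<alpha> | (\<Sum>j\<in>UNIV. \<alpha> j) \<le> m. c \<alpha> * monomial \<alpha> x)"
    using assms unfolding polys_def by auto
  have "(\<lambda>x. \<Sum>\<alpha> | (\<Sum>j\<in>UNIV. \<alpha> j) \<le> m. c \<alpha> * monomial (\<alpha>(i := Suc (\<alpha> i))) x) \<in> polys (Suc m) UNIV"
  proof (intro polys_sum polys_cmult)
    fix \<alpha> :: "'a \<Rightarrow> nat" assume "\<alpha> \<in> {\<alpha>. (\<Sum>j\<in>UNIV. \<alpha> j) \<le> m}"
    then show "monomial (\<alpha>(i := Suc (\<alpha> i))) \<in> polys (Suc m) UNIV"
      using monomial_in_polys[of "\<alpha>(i := Suc (\<alpha> i))" "Suc m" UNIV] multi_index_size_Suc[of \<alpha> i] by simp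
  qed
  then show ?thesis
    by (simp only: monomial_Suc c sum_distrib_left mult.left_commute)
qed

lemma polys_mono: assumes "p \<in> polys m D" "m \<le> m'" shows "p \<in> polys m' D"
proof -
  have "polys m D \<subseteq> polys m' D"
    using span_minimal[of _ "polys m' D", OF _ subspace_polys] polys_in_span[of m D]
      monomial_in_polys[of _ m' D] assms(2)
    by (smt (verit, best) image_subset_iff le_trans mem_Collect_eq subset_trans)
  then show ?thesis using assms by blast
qed

lemma polys_times_affine:
  assumes "p \<in> polys m UNIV" shows "(\<lambda>x. (a \<bullet> x + d) * p x) \<in> polys (Suc m) UNIV"
proof -
  have "(\<lambda>x. (\<Sum>i\<in>UNIV. a $ i * (x $ i * p x)) + d * p x) \<in> polys (Suc m) UNIV"
    by (intro polys_add polys_sum polys_cmult polys_times_coord assms polys_mono[OF assms]) auto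
  moreover have "(\<lambda>x. (\<Sum>i\<in>UNIV. a $ i * (x $ i * p x)) + d * p x) = (\<lambda>x. (a \<bullet> x + d) * p x)"
    by (simp add: inner_vec_def fun_eq_iff distrib_right sum_distrib_right mult.assoc)
  ultimately show ?thesis by simp
qed

lemma polys_times_affine_on:
  assumes "p \<in> polys m D" shows "(\<lambda>x. (a \<bullet> x + d) * p x) \<in> polys (Suc m) D"
proof -
  obtain P where "P \<in> polys m UNIV" "p = zero_ext D P" using assms polys_iff_extension by blast
  then show ?thesis
    using polys_times_affine[of P m a d]
    by (subst polys_iff_extension) (auto simp: fun_eq_iff intro!: bexI[of _ "\<lambda>x. (a \<bullet> x + d) * P x"])
qed

lemma continuous_on_polys: assumes "p \<in> polys m D" shows "continuous_on D p"
proof -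
  obtain c where
    "\<And>x. p x = (if x \<in> D then \<Sum>\<alpha> | (\<Sum>j\<in>UNIV. \<alpha> j) \<le> m. c \<alpha> * monomial \<alpha> x else 0)"
    using assms unfolding polys_def by blast
  then have "continuous_on D p \<longleftrightarrow>
      continuous_on D (\<lambda>x. \<Sum>\<alpha> | (\<Sum>j\<in>UNIV. \<alpha> j) \<le> m. c \<alpha> * monomial \<alpha> x)"
    by (intro continuous_on_cong) auto
  then show ?thesis by (auto intro!: continuous_intros)
qed

lemma polys_outside: "p \<in> polys m D \<Longrightarrow> x \<notin> D \<Longrightarrow> p x = 0"
  by (auto simp: polys_def)

lemma polys_restrict: "p \<in> polys m D \<Longrightarrow> F \<subseteq> D \<Longrightarrow> zero_ext F p \<in> polys m F"
  by (subst polys_iff_extension) (force simp: polys_iff_extension[of p m D] fun_eq_iff)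

lemma polys_on_line:
  assumes "p \<in> polys m UNIV" shows "\<exists>q :: real poly. \<forall>s. p (a + s *\<^sub>R z) = poly q s"
  using assms
proof (induction rule: polys_induct)
  case one
  show ?case by (intro exI[of _ 1]) simp
next
  case (times_coord m p i)
  then obtain q where "\<forall>s. p (a + s *\<^sub>R z) = poly q s" by blast
  then show ?case by (intro exI[of _ "[:a $ i, z $ i:] * q"]) (simp add: algebra_simps)
next
  case zero
  show ?case by (intro exI[of _ 0]) simp
next
  case (add m p q)
  then obtain p' q' where "\<forall>s. p (a + s *\<^sub>R z) = poly p' s" "\<forall>s. q (a + s *\<^sub>R z) = poly q' s" by blast
  then show ?case by (intro exI[of _ "p' + q'"]) simp
next
  case (scale m p r)
  then obtain p' where "\<forall>s. p (a + s *\<^sub>R z) = poly p' s" by blast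
  then show ?case by (intro exI[of _ "smult r p'"]) simp
qed

text \<open>The segment from a relative interior point of \<open>F\<close> to \<open>y\<close> starts inside \<open>F\<close>, so the restriction of
  \<open>p\<close> to it is a univariate polynomial with infinitely many zeros.\<close>

lemma polys_zero_on_affine_hull:
  assumes p: "p \<in> polys m UNIV" and F: "convex F" "F \<noteq> {}"
    and zero: "\<And>x. x \<in> F \<Longrightarrow> p x = 0" and y: "y \<in> affine hull F"
  shows "p y = 0"
proof -
  obtain a where "a \<in> rel_interior F" using F rel_interior_eq_empty by blast
  then obtain e where e: "e > 0" "ball a e \<inter> affine hull F \<subseteq> F" and aF: "a \<in> F"
    by (auto simp: mem_rel_interior_ball)
  obtain q where q: "\<And>s. p (a + s *\<^sub>R (y - a)) = poly q s" using polys_on_line[OF p] by metis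
  define \<delta> where "\<delta> = e / (norm (y - a) + 1)"
  have \<delta>: "\<delta> > 0" using e by (simp add: \<delta>_def add_nonneg_pos)
  have "poly q s = 0" if s: "s \<in> {0<..<\<delta>}" for s
  proof -
    have "a \<in> affine hull F" using aF by (rule hull_inc)
    then have "a + s *\<^sub>R (y - a) \<in> affine hull F"
      using mem_affine[OF affine_affine_hull _ y, of a "1 - s" s] by (simp add: algebra_simps)
    moreover have "norm (s *\<^sub>R (y - a)) < e"
    proof -
      have "s * norm (y - a) \<le> s * (norm (y - a) + 1)" using s by simp
      also have "\<dots> < \<delta> * (norm (y - a) + 1)" using s by (intro mult_strict_right_mono) (auto simp: add_nonneg_pos)
      also have "\<dots> = e" using norm_ge_zero[of "y - a"] by (simp add: \<delta>_def add_nonneg_eq_0_iff)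
      finally show ?thesis using s by simp
    qed
    ultimately have "a + s *\<^sub>R (y - a) \<in> F" using e by (auto simp: dist_norm)
    then show ?thesis using zero q by metis
  qed
  then have "infinite {s. poly q s = 0}"
    using infinite_super[of "{0<..<\<delta>}" "{s. poly q s = 0}"] infinite_Ioo[OF \<delta>] by blast
  then have "q = 0" using poly_roots_finite by blast
  then show ?thesis using q[of 1] by simp
qed

text \<open>Division with remainder by an affine function \<open>n \<bullet> x + d\<close>: the remainder is \<open>p\<close> evaluated at the
  projection of \<open>x\<close> along \<open>w\<close> onto the zero set of that function.\<close>

lemma polys_split_off_affine:
  assumes "p \<in> polys (Suc m) UNIV" and w: "n \<bullet> w = 1"
  shows "\<exists>r\<in>polys m UNIV. \<forall>x. p x = p (x - (n \<bullet> x + d) *\<^sub>R w) + (n \<bullet> x + d) * r x"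
proof -
  let ?\<pi> = "\<lambda>x. x - (n \<bullet> x + d) *\<^sub>R w"
  \<comment> \<open>The induction starts in degree 0, where \<open>m - 1\<close> is truncated; there the quotient must be zero,
    for otherwise the coordinate step would exceed the degree bound.\<close>
  have "\<exists>r\<in>polys (m - 1) UNIV. (m = 0 \<longrightarrow> r = 0) \<and> (\<forall>x. p x = p (?\<pi> x) + (n \<bullet> x + d) * r x)"
    if "p \<in> polys m UNIV" for p m
    using that
  proof (induction rule: polys_induct)
    case one
    show ?case using polys_zero by (intro bexI[of _ 0]) (auto simp: zero_fun_def)
  next
    case (times_coord m p i)
    then obtain r where r: "r \<in> polys (m - 1) UNIV" "m = 0 \<longrightarrow> r = 0"
      "\<And>x. p x = p (?\<pi> x) + (n \<bullet> x + d) * r x" by blast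
    define r' where "r' x = w $ i * p x + ((axis i 1 - w $ i *\<^sub>R n) \<bullet> x + - w $ i * d) * r x" for x
    have "(\<lambda>x. ((axis i 1 - w $ i *\<^sub>R n) \<bullet> x + - w $ i * d) * r x) \<in> polys m UNIV"
    proof (cases m)
      case 0
      then show ?thesis using r polys_zero by simp
    next
      case (Suc l)
      then have "r \<in> polys l UNIV" using r(1) by simp
      then show ?thesis unfolding Suc by (rule polys_times_affine)
    qed
    then have "r' \<in> polys m UNIV"
      unfolding r'_def[abs_def] by (intro polys_add polys_cmult times_coord.hyps)
    moreover have "x $ i * p x = ?\<pi> x $ i * p (?\<pi> x) + (n \<bullet> x + d) * r' x" for x
      unfolding r'_def using r(3)[of x]
      by (simp add: inner_diff_left inner_axis' algebra_simps)
    ultimately show ?case by auto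
  next
    case (mono m p)
    then show ?case using polys_mono[of _ "m - 1" UNIV m] by auto
  next
    case zero
    show ?case using polys_zero by (intro bexI[of _ 0]) (auto simp: zero_fun_def)
  next
    case (add m p q)
    then obtain r s where rs: "r \<in> polys (m - 1) UNIV" "m = 0 \<longrightarrow> r = 0"
        "\<forall>x. p x = p (?\<pi> x) + (n \<bullet> x + d) * r x"
        "s \<in> polys (m - 1) UNIV" "m = 0 \<longrightarrow> s = 0"
        "\<forall>x. q x = q (?\<pi> x) + (n \<bullet> x + d) * s x" by blast
    then have "p x + q x = p (?\<pi> x) + q (?\<pi> x) + (n \<bullet> x + d) * (r x + s x)" for x
      by (metis (no_types, lifting) add.assoc add.left_commute distrib_left)
    moreover have "(\<lambda>x. r x + s x) \<in> polys (m - 1) UNIV" using rs(1,4) by (rule polys_add)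
    moreover have "m = 0 \<longrightarrow> (\<lambda>x. r x + s x) = 0" using rs(2,5) by (auto simp: zero_fun_def)
    ultimately show ?case by (intro bexI[of _ "\<lambda>x. r x + s x"] conjI allI)
  next
    case (scale m p c)
    then obtain r where r: "r \<in> polys (m - 1) UNIV" "m = 0 \<longrightarrow> r = 0"
      "\<forall>x. p x = p (?\<pi> x) + (n \<bullet> x + d) * r x" by blast
    then have "c * p x = c * p (?\<pi> x) + (n \<bullet> x + d) * (c * r x)" for x
      by (metis (no_types, lifting) distrib_left mult.left_commute)
    moreover have "(\<lambda>x. c * r x) \<in> polys (m - 1) UNIV" using r(1) by (rule polys_cmult)
    moreover have "m = 0 \<longrightarrow> (\<lambda>x. c * r x) = 0" using r(2) by (auto simp: zero_fun_def)
    ultimately show ?case by (intro bexI[of _ "\<lambda>x. c * r x"] conjI allI)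
  qed
  from this[OF assms(1)] show ?thesis by auto
qed

text \<open>The remainder of the division only depends on values of \<open>p\<close> in the hyperplane spanned by \<open>F\<close>, and
  a polynomial that vanishes on \<open>F\<close> vanishes on that hyperplane.\<close>

lemma polys_vanishing_on_face_divisible:
  assumes p: "p \<in> polys (Suc m) D" and F: "convex F" "F \<noteq> {}" "F \<subseteq> D"
    and hull: "affine hull F = {x. n \<bullet> x + d = 0}" and n: "n \<noteq> 0"
    and zero: "\<And>x. x \<in> F \<Longrightarrow> p x = 0"
  shows "\<exists>r\<in>polys m D. \<forall>x\<in>D. p x = (n \<bullet> x + d) * r x"
proof -
  obtain P where P: "P \<in> polys (Suc m) UNIV" "p = zero_ext D P"
    using p polys_iff_extension by blast
  define w where "w = (1 / (n \<bullet> n)) *\<^sub>R n"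
  have w: "n \<bullet> w = 1" using n by (simp add: w_def)
  obtain r where r: "r \<in> polys m UNIV" "\<And>x. P x = P (x - (n \<bullet> x + d) *\<^sub>R w) + (n \<bullet> x + d) * r x"
    using polys_split_off_affine[OF P(1) w, of d] by blast
  have "P (x - (n \<bullet> x + d) *\<^sub>R w) = 0" for x
  proof (rule polys_zero_on_affine_hull[OF P(1) F(1,2)])
    show "P x = 0" if "x \<in> F" for x
      using zero[OF that] F that P(2) by auto
    show "x - (n \<bullet> x + d) *\<^sub>R w \<in> affine hull F"
      using w by (simp add: hull inner_diff_right)
  qed
  then have "P x = (n \<bullet> x + d) * r x" for x using r(2)[of x] by simp
  then have "\<forall>x\<in>D. p x = (n \<bullet> x + d) * zero_ext D r x" using P(2) by simp
  moreover have "zero_ext D r \<in> polys m D" using r polys_iff_extension by blast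
  ultimately show ?thesis by (intro bexI[of _ "zero_ext D r"])
qed

section \<open>Matrix-valued polynomials\<close>

text \<open>Expanding with respect to an orthonormal basis of \<open>X\<close> turns the tensor product into a condition on
  the scalar components, which reduces matrix-valued polynomials to scalar ones.\<close>

lemma mat_polys_iff:
  fixes X :: "(real^'n^'n) set"
  assumes X: "subspace X"
  shows "\<tau> \<in> mat_polys m D X \<longleftrightarrow> (\<forall>x. \<tau> x \<in> X) \<and> (\<forall>A. (\<lambda>x. \<tau> x \<bullet> A) \<in> polys m D)"
proof
  assume "\<tau> \<in> mat_polys m D X"
  then show "(\<forall>x. \<tau> x \<in> X) \<and> (\<forall>A. (\<lambda>x. \<tau> x \<bullet> A) \<in> polys m D)"
    unfolding mat_polys_def
  proof (induction rule: span_induct_alt)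
    case base
    show ?case using X polys_zero by (simp add: subspace_0)
  next
    case (step c \<sigma> \<tau>)
    then obtain p A where pA: "\<sigma> = (\<lambda>x. p x *\<^sub>R A)" "p \<in> polys m D" "A \<in> X" by blast
    have "(\<lambda>x. (c * (A \<bullet> B)) * p x + \<tau> x \<bullet> B) \<in> polys m D" for B
      using step pA by (intro polys_add polys_cmult) auto
    then have "(\<lambda>x. (c *\<^sub>R \<sigma> + \<tau>) x \<bullet> B) \<in> polys m D" for B
      by (simp add: pA scaleR_fun_def inner_add_left mult_ac)
    moreover have "(c *\<^sub>R \<sigma> + \<tau>) x \<in> X" for x
      using step pA X by (simp add: scaleR_fun_def subspace_add subspace_scale)
    ultimately show ?case by blast
  qed
next
  assume \<tau>: "(\<forall>x. \<tau> x \<in> X) \<and> (\<forall>A. (\<lambda>x. \<tau> x \<bullet> A) \<in> polys m D)"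
  obtain B where B: "B \<subseteq> X" "pairwise orthogonal B" "\<And>x. x \<in> B \<Longrightarrow> norm x = 1"
    "independent B" "span B = X"
    using orthonormal_basis_subspace[OF X] by metis
  have fin: "finite B" using B(4) by (rule independent_imp_finite)
  have "\<tau> x = (\<Sum>b\<in>B. (\<tau> x \<bullet> b) *\<^sub>R b)" for x
  proof -
    have "\<tau> x \<in> span B" using \<tau> B(5) by blast
    then show ?thesis using orthonormal_basis_expand[OF B(2,3)] fin by simp
  qed
  then have "\<tau> = (\<Sum>b\<in>B. (\<lambda>x. (\<tau> x \<bullet> b) *\<^sub>R b))"
    by (simp add: fun_eq_iff sum_fun_apply)
  also have "\<dots> \<in> mat_polys m D X"
    unfolding mat_polys_def
  proof (intro span_sum span_base CollectI)
    fix b assume "b \<in> B"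
    then show "\<exists>p A. (\<lambda>x. (\<tau> x \<bullet> b) *\<^sub>R b) = (\<lambda>x. p x *\<^sub>R A) \<and> p \<in> polys m D \<and> A \<in> X"
      using \<tau> B(1) by (intro exI[of _ "\<lambda>x. \<tau> x \<bullet> b"] exI[of _ b]) auto
  qed
  finally show "\<tau> \<in> mat_polys m D X" .
qed

lemma subspace_mat_polys: "subspace (mat_polys m D X)"
  by (simp add: mat_polys_def)

lemma continuous_on_mat_polys:
  assumes "subspace X" "\<tau> \<in> mat_polys m D X" shows "continuous_on D \<tau>"
proof -
  have "continuous_on D (\<lambda>x. \<tau> x \<bullet> A)" for A
    using assms by (auto simp: mat_polys_iff intro: continuous_on_polys)
  then show ?thesis using continuous_on_componentwise by blast
qed

lemma mat_polys_finite_span: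
  assumes X: "subspace (X :: (real^'n^'n) set)"
  shows "\<exists>S. finite S \<and> mat_polys m D X = span S"
proof -
  obtain S where S: "finite S" "polys m D = span S" using polys_finite_span by blast
  obtain Z where Z: "finite Z" "Z \<subseteq> X" "X = span Z" using X
    by (metis basis_subspace_exists subspace_def)
  let ?R = "(\<lambda>(p, A). (\<lambda>x. p x *\<^sub>R A)) ` (S \<times> Z)"
  have "(\<lambda>x. p x *\<^sub>R A) \<in> span ?R" if p: "p \<in> span S" and A: "A \<in> span Z" for p A
    using p
  proof (induction rule: span_induct_alt)
    case base
    show ?case using span_zero[of ?R] by (simp add: zero_fun_def)
  next
    case (step c q p)
    have "(\<lambda>x. q x *\<^sub>R A) \<in> span ?R"
      using A
    proof (induction rule: span_induct_alt)
      case base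
      show ?case using span_zero[of ?R] by (simp add: zero_fun_def)
    next
      case (step c' A' A)
      have "(\<lambda>x. q x *\<^sub>R A') \<in> span ?R" using step \<open>q \<in> S\<close> by (intro span_base) auto
      then have "c' *\<^sub>R (\<lambda>x. q x *\<^sub>R A') + (\<lambda>x. q x *\<^sub>R A) \<in> span ?R"
        using step by (intro span_add span_scale)
      moreover have "c' *\<^sub>R (\<lambda>x. q x *\<^sub>R A') + (\<lambda>x. q x *\<^sub>R A) = (\<lambda>x. q x *\<^sub>R (c' *\<^sub>R A' + A))"
        by (auto simp: scaleR_fun_def fun_eq_iff scaleR_add_right)
      ultimately show ?case by simp
    qed
    then have "c *\<^sub>R (\<lambda>x. q x *\<^sub>R A) + (\<lambda>x. p x *\<^sub>R A) \<in> span ?R"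
      using step by (intro span_add span_scale)
    moreover have "c *\<^sub>R (\<lambda>x. q x *\<^sub>R A) + (\<lambda>x. p x *\<^sub>R A) = (\<lambda>x. (c *\<^sub>R q + p) x *\<^sub>R A)"
      by (auto simp: scaleR_fun_def fun_eq_iff scaleR_add_left)
    ultimately show ?case by simp
  qed
  then have "mat_polys m D X \<subseteq> span ?R"
    unfolding mat_polys_def S Z by (intro span_minimal) auto
  moreover have "span ?R \<subseteq> mat_polys m D X"
    unfolding mat_polys_def using S Z span_superset by (intro span_mono) fastforce
  ultimately show ?thesis using S Z by (intro exI[of _ ?R]) auto
qed

lemma subspace_sym_mats: "subspace (sym_mats :: (real^'n^'n) set)"
  by (rule subspaceI) (auto simp: sym_mats_def transpose_def vec_eq_iff)

lemma subspace_skew_mats: "subspace (skew_mats :: (real^'n^'n) set)"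
proof -
  have "linear (\<lambda>A :: real^'n^'n. transpose A + A)"
    by (rule linearI) (auto simp: transpose_def vec_eq_iff algebra_simps)
  from linear_subspace_kernel[OF this] show ?thesis
    by (simp add: skew_mats_def eq_neg_iff_add_eq_0)
qed

lemma subspace_traceless_mats: "subspace (traceless_mats :: (real^'n^'n) set)"
  by (rule subspaceI) (auto simp: traceless_mats_def trace_add trace_scaleR trace_0[simplified mat_0])

lemma mat_polys_outside:
  assumes "subspace X" "\<tau> \<in> mat_polys m D X" "x \<notin> D" shows "\<tau> x = 0"
proof -
  have "(\<lambda>y. \<tau> y \<bullet> \<tau> x) \<in> polys m D" using assms(2) by (simp add: mat_polys_iff[OF assms(1)])
  from polys_outside[OF this assms(3)] show ?thesis by simp
qed

lemma inner_sym_skew: assumes "A \<in> sym_mats" "B \<in> skew_mats" shows "A \<bullet> B = 0"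
proof -
  have "transpose A \<bullet> transpose B = A \<bullet> B"
    unfolding inner_vec_def transpose_def by simp (rule sum.swap)
  then have "A \<bullet> (- B) = A \<bullet> B" using assms by (simp add: sym_mats_def skew_mats_def)
  then show ?thesis by simp
qed

lemma skew_mats_traceless: "skew_mats \<subseteq> traceless_mats"
proof
  fix A :: "real^'n^'n" assume "A \<in> skew_mats"
  then have "trace (transpose A) = - trace A"
    by (simp add: skew_mats_def trace_def sum_negf)
  then show "A \<in> traceless_mats" by (simp add: traceless_mats_def trace_def transpose_def)
qed

lemma mat_polys_subset: "X \<subseteq> Y \<Longrightarrow> mat_polys m D X \<subseteq> mat_polys m D Y"
  unfolding mat_polys_def by (intro span_mono) blast

lemma mat_polys_mono: assumes "subspace X" "m \<le> m'" shows "mat_polys m D X \<subseteq> mat_polys m' D X"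
proof -
  have "polys m D \<subseteq> polys m' D" using polys_mono assms(2) by blast
  then show ?thesis unfolding subset_iff mat_polys_iff[OF assms(1)] by simp
qed

lemma mat_polys_scale_poly:
  assumes "p \<in> polys m D" "A \<in> X" shows "(\<lambda>x. p x *\<^sub>R A) \<in> mat_polys m D X"
  unfolding mat_polys_def using assms by (intro span_base) blast

lemma mat_polys_traceless_split:
  assumes q: "q \<in> mat_polys m D traceless_mats"
  shows "\<exists>s\<in>mat_polys m D (sym_mats \<inter> traceless_mats). \<exists>a\<in>mat_polys m D skew_mats. q = s + a"
proof -
  have "(\<lambda>x. p x *\<^sub>R A) \<in> {s + a |s a. s \<in> mat_polys m D (sym_mats \<inter> traceless_mats) \<and> a \<in> mat_polys m D skew_mats}"
    if p: "p \<in> polys m D" and A: "A \<in> traceless_mats" for p A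
  proof -
    define S where "S = (1/2) *\<^sub>R (A + transpose A)"
    define K where "K = (1/2) *\<^sub>R (A - transpose A)"
    have "trace (transpose A) = 0" using A by (simp add: traceless_mats_def trace_def transpose_def)
    then have "S \<in> sym_mats \<inter> traceless_mats"
      using A by (auto simp: S_def sym_mats_def traceless_mats_def transpose_def
          trace_scaleR trace_add vec_eq_iff add.commute)
    moreover have "K \<in> skew_mats"
      by (simp add: K_def skew_mats_def transpose_def vec_eq_iff field_simps)
    moreover have "A = S + K" by (simp add: S_def K_def scaleR_add_right scaleR_diff_right flip: scaleR_add_left)
    then have "(\<lambda>x. p x *\<^sub>R A) = (\<lambda>x. p x *\<^sub>R S) + (\<lambda>x. p x *\<^sub>R K)"
      by (simp add: fun_eq_iff scaleR_add_right)
    ultimately show ?thesis using mat_polys_scale_poly p by blast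
  qed
  then have "mat_polys m D traceless_mats \<subseteq>
      {s + a |s a. s \<in> mat_polys m D (sym_mats \<inter> traceless_mats) \<and> a \<in> mat_polys m D skew_mats}"
    unfolding mat_polys_def[of m D traceless_mats]
    by (intro span_minimal subspace_sums subspace_mat_polys) blast
  then show ?thesis using q by blast
qed

section \<open>Measures of full support\<close>

text \<open>The properties that make the inner product of \<open>L\<^sup>2(D)\<close> finite and positive definite on continuous
  functions. They hold for the Lebesgue measure on a simplex and for the surface measure on a facet,
  so both are treated at once.\<close>

definition full_support :: "'a::euclidean_space measure \<Rightarrow> 'a set \<Rightarrow> bool" where
  "full_support M D \<longleftrightarrow> sets M = sets borel \<and> compact D \<and> emeasure M D < \<infinity> \<and>
     (\<forall>x\<in>D. \<forall>r>0. emeasure M (D \<inter> ball x r) \<noteq> 0)"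

lemma full_support_set_integrable:
  fixes f :: "'a::euclidean_space \<Rightarrow> real"
  assumes M: "full_support M D" and f: "continuous_on D f"
  shows "set_integrable M D f"
proof -
  have D: "compact D" "D \<in> sets M" and fin: "emeasure M D < \<infinity>" and sets: "sets M = sets borel"
    using M by (auto simp: full_support_def borel_compact)
  have "bounded (f ` D)"
    using compact_continuous_image[OF f D(1)] compact_imp_bounded by blast
  then obtain B where B: "\<And>x. x \<in> D \<Longrightarrow> norm (f x) \<le> B"
    unfolding bounded_iff by blast
  have "(\<lambda>x. indicator D x *\<^sub>R f x) \<in> borel_measurable borel"
    by (intro borel_measurable_continuous_on_indicator f borel_compact D)
  then have meas: "(\<lambda>x. indicator D x *\<^sub>R f x) \<in> borel_measurable M"
    by (simp cong: measurable_cong_sets add: sets)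
  show ?thesis
    unfolding set_integrable_def
    by (rule integrableI_bounded_set[OF D(2) meas fin, of B])
       (use B in \<open>auto simp: indicator_def\<close>)
qed

lemma full_support_integral_eq_0:
  fixes f :: "'a::euclidean_space \<Rightarrow> real"
  assumes M: "full_support M D" and f: "continuous_on D f" and nonneg: "\<And>x. x \<in> D \<Longrightarrow> f x \<ge> 0"
    and int: "(LINT x:D|M. f x) = 0" and x: "x \<in> D"
  shows "f x = 0"
proof (rule ccontr)
  assume "f x \<noteq> 0"
  then have pos: "f x > 0" using nonneg[OF x] by simp
  have sets: "sets M = sets borel" and D: "compact D" using M by (auto simp: full_support_def)
  obtain r where r: "r > 0" "\<And>y. y \<in> D \<Longrightarrow> dist y x < r \<Longrightarrow> dist (f y) (f x) < f x"
    using f x pos unfolding continuous_on_iff by blast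
  have ae: "AE y in M. indicator D y *\<^sub>R f y = 0"
    using integral_nonneg_eq_0_iff_AE[OF full_support_set_integrable[OF M f, unfolded set_integrable_def]]
      int nonneg unfolding set_lebesgue_integral_def by (auto simp: indicator_def)
  have "AE y in M. y \<notin> D \<inter> ball x r"
    using ae
  proof (eventually_elim)
    case (elim y)
    show ?case
    proof
      assume y: "y \<in> D \<inter> ball x r"
      then have "dist (f y) (f x) < f x" using r(2)[of y] by (simp add: dist_commute)
      then show False using elim y by (auto simp: dist_real_def)
    qed
  qed
  moreover have "D \<inter> ball x r \<in> sets M" using D by (auto simp: sets borel_compact)
  ultimately have "D \<inter> ball x r \<in> null_sets M"
    using AE_iff_null_sets by blast
  then have "emeasure M (D \<inter> ball x r) = 0" by auto
  then show False using M x r by (auto simp: full_support_def)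
qed

text \<open>A convex body is the closure of its interior, so each ball around one of its points meets the
  interior in a nonempty open set.\<close>

lemma full_support_lborel:
  fixes D :: "'a::euclidean_space set"
  assumes "compact D" "convex D" "interior D \<noteq> {}"
  shows "full_support lborel D"
  unfolding full_support_def
proof (intro conjI ballI allI impI)
  show "emeasure lborel D < \<infinity>" using assms emeasure_bounded_finite[of D] compact_imp_bounded by blast
next
  fix x and r :: real assume x: "x \<in> D" and r: "r > 0"
  let ?U = "interior D \<inter> ball x r"
  have "x \<in> closure (interior D)"
    using convex_closure_interior[OF assms(2,3)] closure_subset x by blast
  then obtain y where "y \<in> interior D" "dist y x < r"
    using r unfolding closure_approachable by blast
  then have "?U \<noteq> {}" by (auto simp: dist_commute)
  then have "\<not> negligible ?U" using open_not_negligible[of ?U] by auto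
  show "emeasure lborel (D \<inter> ball x r) \<noteq> 0"
  proof
    assume "emeasure lborel (D \<inter> ball x r) = 0"
    moreover have "D \<inter> ball x r \<in> sets lborel" using assms by (auto simp: borel_compact)
    ultimately have "D \<inter> ball x r \<in> null_sets lborel" by (rule null_setsI)
    then have "D \<inter> ball x r \<in> null_sets lebesgue" by (rule null_sets_completionI)
    then have "negligible (D \<inter> ball x r)" by (simp add: negligible_iff_null_sets)
    then show False using \<open>\<not> negligible ?U\<close> negligible_subset interior_subset
      by (metis Int_mono order_refl)
  qed
qed (use assms in auto)

lemma translate_tangent_space:
  assumes "a \<in> F" "w \<in> tangent_space F" shows "a + w \<in> affine hull F"
proof -
  obtain x y where xy: "w = x - y" "x \<in> affine hull F" "y \<in> affine hull F"
    using assms(2) unfolding tangent_space_def by blast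
  then show ?thesis
    using mem_affine_3_minus[OF affine_affine_hull hull_inc[OF assms(1)] xy(2,3), of 1] by simp
qed

text \<open>The parametrization of the hyperplane preserves distances. A relatively open part of \<open>F\<close> therefore
  contains the image of a coordinate box, and \<open>F\<close> itself lies in the image of a bounded one.\<close>

lemma full_support_surface_measure:
  fixes F :: "(real^'n) set"
  assumes F: "compact F" "convex F" "F \<noteq> {}" and t: "orthonormal_tangent_basis F t"
  shows "full_support (surface_measure F) F"
proof -
  define a where "a = (SOME a. a \<in> F)"
  define u where "u = (SOME u. orthonormal_tangent_basis F u)"
  have a: "a \<in> F" unfolding a_def using F by (simp add: some_in_eq)
  have u: "orthonormal_tangent_basis F u" unfolding u_def by (rule someI[of _ t]) (rule t)
  define I where "I = {1..CARD('n) - 1}"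
  define \<Psi> where "\<Psi> y = a + (\<Sum>i\<in>I. y i *\<^sub>R u i)" for y :: "nat \<Rightarrow> real"
  define P where "P = Pi\<^sub>M I (\<lambda>_. lborel :: real measure)"
  have S: "surface_measure F = distr P borel \<Psi>"
    by (simp add: surface_measure_def a_def u_def I_def \<Psi>_def[abs_def] P_def Let_def)
  have fin[simp]: "finite I" by (simp add: I_def)
  have ortho: "u i \<bullet> u j = (if i = j then 1 else 0)" if "i \<in> I" "j \<in> I" for i j
    using u that unfolding orthonormal_tangent_basis_def I_def by blast
  have span_u: "span (u ` I) = tangent_space F"
    using u unfolding orthonormal_tangent_basis_def I_def by blast
  interpret product_sigma_finite "\<lambda>_ :: nat. lborel :: real measure" ..
  have \<Psi>_meas: "\<Psi> \<in> measurable P borel"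
    unfolding \<Psi>_def[abs_def] P_def by measurable
  have coord: "(\<Psi> y - a) \<bullet> u i = y i" if "i \<in> I" for y i
    using that by (simp add: \<Psi>_def inner_sum_left ortho if_distrib cong: if_cong)
  have hull: "\<Psi> y \<in> affine hull F" for y
    unfolding \<Psi>_def
    by (intro translate_tangent_space a) (auto simp: span_u[symmetric] intro: span_sum span_scale span_base)
  have surj: "\<exists>y. \<Psi> y = x" if x: "x \<in> affine hull F" for x
  proof -
    have "x - a \<in> tangent_space F"
      unfolding tangent_space_def using x hull_inc[OF a] by blast
    then have "x - a \<in> span (u ` I)" by (simp add: span_u)
    moreover have "inj_on u I"
      by (rule inj_onI) (metis ortho zero_neq_one)
    ultimately obtain v where "x - a = (\<Sum>w\<in>u ` I. v w *\<^sub>R w)"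
      using span_finite[of "u ` I"] by auto
    then have "x - a = (\<Sum>i\<in>I. v (u i) *\<^sub>R u i)"
      using \<open>inj_on u I\<close> by (simp add: sum.reindex)
    then show ?thesis by (intro exI[of _ "\<lambda>i. v (u i)"]) (simp add: \<Psi>_def algebra_simps)
  qed
  have emeasure_S: "emeasure (surface_measure F) A = emeasure P (\<Psi> -` A \<inter> space P)"
    if "A \<in> sets borel" for A
    unfolding S using that by (intro emeasure_distr \<Psi>_meas)
  show ?thesis
    unfolding full_support_def
  proof (intro conjI ballI allI impI)
    show "sets (surface_measure F) = sets borel" by (simp add: S)
    show "compact F" by (rule F(1))
    obtain R where R: "\<And>x. x \<in> F \<Longrightarrow> dist a x \<le> R"
      using compact_imp_bounded[OF F(1)] unfolding bounded_any_center[of _ a] by blast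
    have "\<Psi> -` F \<inter> space P \<subseteq> Pi\<^sub>E I (\<lambda>_. {-R..R})"
    proof
      fix y assume y: "y \<in> \<Psi> -` F \<inter> space P"
      have "\<bar>y i\<bar> \<le> R" if i: "i \<in> I" for i
      proof -
        have "\<bar>y i\<bar> = \<bar>(\<Psi> y - a) \<bullet> u i\<bar>" using coord[OF i] by simp
        also have "\<dots> \<le> norm (\<Psi> y - a) * norm (u i)" by (rule Cauchy_Schwarz_ineq2)
        also have "norm (u i) = 1" using ortho[OF i i] by (simp add: norm_eq_1)
        finally show ?thesis using R[of "\<Psi> y"] y by (simp add: dist_norm norm_minus_commute)
      qed
      then show "y \<in> Pi\<^sub>E I (\<lambda>_. {-R..R})"
        using y by (auto simp: P_def space_PiM PiE_iff abs_le_iff) (smt (verit))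
    qed
    then have "emeasure P (\<Psi> -` F \<inter> space P) \<le> emeasure P (Pi\<^sub>E I (\<lambda>_. {-R..R}))"
      by (rule emeasure_mono) (auto simp: P_def)
    also have "\<dots> < \<infinity>"
      unfolding P_def
      by (subst emeasure_PiM) (auto simp: emeasure_lborel_Icc_eq power_less_top_ennreal zero_less_power)
    finally show "emeasure (surface_measure F) F < \<infinity>"
      using emeasure_S[of F] F by (simp add: borel_compact)
  next
    fix x and r :: real assume x: "x \<in> F" and r: "r > 0"
    have "x \<in> closure (rel_interior F)"
      using convex_closure_rel_interior[OF F(2)] closure_subset x by blast
    then obtain z where z: "z \<in> rel_interior F" "dist z x < r"
      using r by (auto simp: closure_approachable)
    then obtain e where e: "e > 0" "ball z e \<inter> affine hull F \<subseteq> F" "z \<in> F"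
      by (auto simp: mem_rel_interior_ball)
    define \<epsilon> where "\<epsilon> = min e (r - dist z x)"
    have \<epsilon>: "\<epsilon> > 0" using e z by (simp add: \<epsilon>_def)
    obtain y where y: "\<Psi> y = z" using surj hull_inc[OF e(3)] by blast
    define \<delta> where "\<delta> = \<epsilon> / (real (card I) + 1)"
    have \<delta>: "\<delta> > 0" using \<epsilon> by (simp add: \<delta>_def)
    let ?B = "Pi\<^sub>E I (\<lambda>i. {y i - \<delta><..<y i + \<delta>})"
    have "?B \<subseteq> \<Psi> -` (F \<inter> ball x r) \<inter> space P"
    proof
      fix y' assume y': "y' \<in> ?B"
      have "norm (\<Psi> y' - z) = norm (\<Sum>i\<in>I. (y' i - y i) *\<^sub>R u i)"
        by (simp add: y[symmetric] \<Psi>_def scaleR_diff_left sum_subtractf)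
      also have "\<dots> \<le> (\<Sum>i\<in>I. \<delta>)"
      proof (rule sum_norm_le)
        fix i assume i: "i \<in> I"
        then have "\<bar>y' i - y i\<bar> < \<delta>" using y' by (force simp: PiE_iff)
        moreover have "norm (u i) = 1" using ortho[OF i i] by (simp add: norm_eq_1)
        ultimately show "norm ((y' i - y i) *\<^sub>R u i) \<le> \<delta>" by simp
      qed
      also have "\<dots> < \<epsilon>" using \<epsilon> by (simp add: \<delta>_def field_simps)
      finally have d: "dist z (\<Psi> y') < \<epsilon>" by (simp add: dist_norm norm_minus_commute)
      then have "\<Psi> y' \<in> F" using e(2) hull[of y'] by (auto simp: \<epsilon>_def)
      moreover have "dist x (\<Psi> y') < r"
        using d dist_triangle[of x "\<Psi> y'" z] by (simp add: \<epsilon>_def dist_commute)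
      ultimately show "y' \<in> \<Psi> -` (F \<inter> ball x r) \<inter> space P"
        using y' by (auto simp: P_def space_PiM)
    qed
    moreover have F_ball: "F \<inter> ball x r \<in> sets borel" using F by (auto simp: borel_compact)
    ultimately have "emeasure P ?B \<le> emeasure (surface_measure F) (F \<inter> ball x r)"
      unfolding emeasure_S[OF F_ball]
      by (intro emeasure_mono measurable_sets[OF \<Psi>_meas])
    moreover have "emeasure P ?B = (\<Prod>i\<in>I. ennreal (2 * \<delta>))"
      unfolding P_def using \<delta> by (subst emeasure_PiM) auto
    moreover have "(\<Prod>i\<in>I. ennreal (2 * \<delta>)) \<noteq> 0" using \<delta> by simp
    ultimately show "emeasure (surface_measure F) (F \<inter> ball x r) \<noteq> 0" by auto
  qed
qed

section \<open>The inner product on continuous functions\<close>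

lemma continuous_on_inner_integrable:
  fixes f g :: "'a::euclidean_space \<Rightarrow> 'b::real_inner"
  assumes "full_support M D" "continuous_on D f" "continuous_on D g"
  shows "set_integrable M D (\<lambda>x. f x \<bullet> g x)"
  using assms by (intro full_support_set_integrable continuous_on_inner)

lemma L2_inner_cong:
  "(\<And>x. x \<in> D \<Longrightarrow> f x \<bullet> g x = f' x \<bullet> g' x) \<Longrightarrow> L2_inner M D f g = L2_inner M D f' g'"
  unfolding L2_inner_def set_lebesgue_integral_def
  by (rule Bochner_Integration.integral_cong) (auto simp: indicator_def)

lemma L2_inner_commute: "L2_inner M D f g = L2_inner M D g f"
  by (simp add: L2_inner_def inner_commute)

context
  fixes M :: "'a::euclidean_space measure" and D
  assumes M: "full_support M D"
begin

lemma L2_inner_add_left: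
  assumes "continuous_on D f" "continuous_on D g" "continuous_on D h"
  shows "L2_inner M D (f + g) h = L2_inner M D f h + L2_inner M D g h"
  unfolding L2_inner_def using assms
  by (simp add: inner_add_left continuous_on_inner_integrable[OF M])

lemma L2_inner_scale_left: "L2_inner M D (c *\<^sub>R f) h = c * L2_inner M D f h"
  unfolding L2_inner_def by (simp add: scaleR_fun_def)

lemma L2_inner_zero_left: "L2_inner M D 0 h = 0"
  unfolding L2_inner_def by simp

lemma L2_inner_add_right:
  assumes "continuous_on D f" "continuous_on D g" "continuous_on D h"
  shows "L2_inner M D h (f + g) = L2_inner M D h f + L2_inner M D h g"
  using L2_inner_add_left[OF assms] by (simp add: L2_inner_commute)

lemma L2_inner_scale_right: "L2_inner M D h (c *\<^sub>R f) = c * L2_inner M D h f"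
  using L2_inner_scale_left by (simp add: L2_inner_commute[of M D h])

lemma L2_inner_diff_left:
  assumes "continuous_on D f" "continuous_on D g" "continuous_on D h"
  shows "L2_inner M D (f - g) h = L2_inner M D f h - L2_inner M D g h"
proof -
  have "continuous_on D ((-1) *\<^sub>R g)" using assms(2) by (simp add: scaleR_fun_def continuous_intros)
  then have "L2_inner M D (f + (-1) *\<^sub>R g) h = L2_inner M D f h - L2_inner M D g h"
    using L2_inner_add_left[of f "(-1) *\<^sub>R g" h] L2_inner_scale_left[of "-1" g h] assms by simp
  then show ?thesis by simp
qed

lemma L2_inner_sum_left:
  assumes "\<And>i. i \<in> I \<Longrightarrow> continuous_on D (f i)" "continuous_on D h"
  shows "L2_inner M D (\<Sum>i\<in>I. f i) h = (\<Sum>i\<in>I. L2_inner M D (f i) h)"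
  using assms(1)
proof (induction I rule: infinite_finite_induct)
  case (insert i I)
  have "continuous_on D (\<Sum>i\<in>I. f i)"
    using insert by (auto simp: sum_fun_apply[abs_def] intro!: continuous_intros)
  then have "L2_inner M D (f i + (\<Sum>i\<in>I. f i)) h = L2_inner M D (f i) h + L2_inner M D (\<Sum>i\<in>I. f i) h"
    using insert.prems assms(2) by (intro L2_inner_add_left) auto
  then show ?case using insert by (simp del: plus_fun_apply)
qed (auto simp: L2_inner_zero_left)

lemma L2_inner_sum_right:
  assumes "\<And>i. i \<in> I \<Longrightarrow> continuous_on D (f i)" "continuous_on D h"
  shows "L2_inner M D h (\<Sum>i\<in>I. f i) = (\<Sum>i\<in>I. L2_inner M D h (f i))"
  using L2_inner_sum_left[OF assms] by (simp add: L2_inner_commute[of M D h])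

lemma L2_inner_self_eq_0:
  assumes "continuous_on D f" "L2_inner M D f f = 0" "x \<in> D"
  shows "f x = 0"
  using full_support_integral_eq_0[OF M _ _ assms(2)[unfolded L2_inner_def] assms(3)] assms(1)
  by (simp add: continuous_on_inner)

end

lemma L2_inner_zero_on_span:
  assumes M: "full_support M D" and f: "continuous_on D f"
    and B: "\<And>q. q \<in> B \<Longrightarrow> continuous_on D q \<and> L2_inner M D f q = 0"
    and q: "q \<in> span B"
  shows "L2_inner M D f q = 0"
proof -
  have "continuous_on D q \<and> L2_inner M D f q = 0"
    using q
  proof (induction rule: span_induct_alt)
    case base
    show ?case
      using L2_inner_zero_left[OF M, of f]
      by (simp add: L2_inner_commute[of M D f] zero_fun_def)
  next
    case (step c q r)
    then have q: "continuous_on D q" "L2_inner M D f q = 0" using B by auto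
    then have cq: "continuous_on D (c *\<^sub>R q)" by (simp add: scaleR_fun_def continuous_intros)
    moreover have "continuous_on D (c *\<^sub>R q + r)"
      using cq step by (auto simp: plus_fun_def intro: continuous_on_add)
    moreover have "L2_inner M D f (c *\<^sub>R q + r) = 0"
      using L2_inner_add_right[OF M cq _ f, of r] L2_inner_scale_right[OF M, of f c q] q step by simp
    ultimately show ?case by blast
  qed
  then show ?thesis by blast
qed

lemma L2_inner_double_sum_left:
  assumes M: "full_support M D" and h: "continuous_on D h"
    and f: "\<And>i j. i \<in> I \<Longrightarrow> j \<in> J \<Longrightarrow> continuous_on D (f i j)"
  shows "L2_inner M D (\<Sum>i\<in>I. \<Sum>j\<in>J. f i j) h = (\<Sum>i\<in>I. \<Sum>j\<in>J. L2_inner M D (f i j) h)"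
proof -
  have cont: "continuous_on D (\<Sum>j\<in>J. f i j)" if "i \<in> I" for i
  proof -
    have "(\<Sum>j\<in>J. f i j) = (\<lambda>x. \<Sum>j\<in>J. f i j x)" by (simp add: fun_eq_iff sum_fun_apply)
    then show ?thesis using f[OF that] by (auto intro: continuous_on_sum)
  qed
  have "L2_inner M D (\<Sum>i\<in>I. \<Sum>j\<in>J. f i j) h = (\<Sum>i\<in>I. L2_inner M D (\<Sum>j\<in>J. f i j) h)"
    by (rule L2_inner_sum_left[OF M cont h])
  also have "\<dots> = (\<Sum>i\<in>I. \<Sum>j\<in>J. L2_inner M D (f i j) h)"
    by (intro sum.cong refl L2_inner_sum_left[OF M f h])
  finally show ?thesis .
qed

section \<open>Linear systems and unisolvence\<close>

lemma homogeneous_system_nontrivial: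
  fixes a :: "'i \<Rightarrow> 'j \<Rightarrow> real"
  assumes fin: "finite I" "finite J" and card: "card J < card I"
  shows "\<exists>c. (\<exists>i\<in>I. c i \<noteq> 0) \<and> (\<forall>j\<in>J. (\<Sum>i\<in>I. c i * a i j) = 0)"
proof (rule ccontr)
  assume "\<not> ?thesis"
  then have indep: "\<And>c i. \<lbrakk>\<forall>j\<in>J. (\<Sum>i\<in>I. c i * a i j) = 0; i \<in> I\<rbrakk> \<Longrightarrow> c i = 0" by blast
  define r where "r i = (\<lambda>j. if j \<in> J then a i j else 0)" for i
  define e where "e k = (\<lambda>j :: 'j. if j = k then (1::real) else 0)" for k
  have zero: "c i = 0" if "(\<Sum>i\<in>I. c i *\<^sub>R r i) = 0" "i \<in> I" for c i
  proof (rule indep[of c, OF _ that(2)], intro ballI)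
    fix j assume "j \<in> J"
    then show "(\<Sum>i\<in>I. c i * a i j) = 0"
      using fun_cong[OF that(1), of j] by (simp add: sum_fun_apply scaleR_fun_def r_def)
  qed
  have inj: "inj_on r I"
  proof (rule inj_onI, rule ccontr)
    fix i k assume ik: "i \<in> I" "k \<in> I" "r i = r k" "i \<noteq> k"
    have "(\<Sum>z\<in>I. ((if z = i then 1 else 0) - (if z = k then 1 else 0)) *\<^sub>R r z)
        = (\<Sum>z\<in>I. (if z = i then r z else 0) - (if z = k then r z else 0))"
      by (rule sum.cong) auto
    also have "\<dots> = 0" using ik fin by (simp add: sum_subtractf)
    finally show False using zero[of "\<lambda>z. (if z = i then 1 else 0) - (if z = k then 1 else 0)" i] ik by simp
  qed
  have "independent (r ` I)"
    unfolding independent_explicit_module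
  proof (intro allI impI)
    fix S u v assume S: "finite S" "S \<subseteq> r ` I" "(\<Sum>v\<in>S. u v *\<^sub>R v) = 0" "v \<in> S"
    define c where "c i = (if r i \<in> S then u (r i) else 0)" for i
    have "(\<Sum>i\<in>I. c i *\<^sub>R r i) = (\<Sum>v\<in>r ` I. (if v \<in> S then u v else 0) *\<^sub>R v)"
      using inj by (simp add: sum.reindex c_def)
    also have "\<dots> = (\<Sum>v\<in>S. u v *\<^sub>R v)"
      using S fin by (intro sum.mono_neutral_cong_right) auto
    finally have "(\<Sum>i\<in>I. c i *\<^sub>R r i) = 0" using S by simp
    moreover obtain i where "i \<in> I" "v = r i" using S by blast
    ultimately show "u v = 0" using zero[of c i] S by (simp add: c_def)
  qed
  moreover have "r i \<in> span (e ` J)" for i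
  proof -
    have "r i = (\<Sum>j\<in>J. a i j *\<^sub>R e j)"
      using fin by (auto simp: fun_eq_iff sum_fun_apply scaleR_fun_def r_def e_def if_distrib cong: if_cong)
    also have "\<dots> \<in> span (e ` J)" by (intro span_sum span_scale span_base) auto
    finally show ?thesis .
  qed
  ultimately have "card (r ` I) \<le> card (e ` J)"
    using independent_span_bound[of "e ` J" "r ` I"] fin by blast
  also have "\<dots> \<le> card J" using fin by (simp add: card_image_le)
  finally show False using card inj by (simp add: card_image)
qed

text \<open>In terms of a basis of \<open>V\<close>, injectivity and independence say that the matrix of the functionals has
  trivial kernel on either side, so it is square.\<close>

lemma unisolventI:
  fixes l :: "'i \<Rightarrow> 'v::real_vector \<Rightarrow> real"
  assumes V: "subspace V" and S: "finite S" "V \<subseteq> span S"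
    and I: "finite I"
    and add: "\<And>i x y. i \<in> I \<Longrightarrow> x \<in> V \<Longrightarrow> y \<in> V \<Longrightarrow> l i (x + y) = l i x + l i y"
    and scale: "\<And>i c x. i \<in> I \<Longrightarrow> x \<in> V \<Longrightarrow> l i (c *\<^sub>R x) = c * l i x"
    and inj: "\<And>x. x \<in> V \<Longrightarrow> (\<And>i. i \<in> I \<Longrightarrow> l i x = 0) \<Longrightarrow> x = 0"
    and indep: "\<And>c i. (\<And>x. x \<in> V \<Longrightarrow> (\<Sum>i\<in>I. c i * l i x) = 0) \<Longrightarrow> i \<in> I \<Longrightarrow> c i = 0"
  shows "unisolvent V I l"
proof -
  obtain B where B: "B \<subseteq> V" "independent B" "V \<subseteq> span B" "card B = dim V"
    using basis_exists by blast
  have finB: "finite B" using independent_span_bound[OF S(1) B(2)] B(1) S(2) by blast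
  have spanB: "span B = V" using B span_minimal[OF B(1) V] by blast
  have zero: "l i 0 = 0" if "i \<in> I" for i
    using scale[OF that subspace_0[OF V], of 0] by simp
  have comb: "(\<Sum>b\<in>A. c b *\<^sub>R b) \<in> V \<and> l i (\<Sum>b\<in>A. c b *\<^sub>R b) = (\<Sum>b\<in>A. c b * l i b)"
    if i: "i \<in> I" and A: "A \<subseteq> B" for i c A
    using finite_subset[OF A finB] A
  proof (induction A rule: finite_induct)
    case empty
    then show ?case using subspace_0[OF V] zero[OF i] by simp
  next
    case (insert b A)
    then have "b \<in> V" using B by blast
    then have "c b *\<^sub>R b \<in> V" by (rule subspace_scale[OF V])
    then show ?case using insert add[OF i] scale[OF i \<open>b \<in> V\<close>] subspace_add[OF V] by simp
  qed
  have "card B \<le> card I"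
  proof (rule ccontr)
    assume "\<not> ?thesis"
    then obtain c where c: "\<exists>b\<in>B. c b \<noteq> 0" "\<forall>i\<in>I. (\<Sum>b\<in>B. c b * l i b) = 0"
      using homogeneous_system_nontrivial[OF finB I, of "\<lambda>b i. l i b"] by auto
    have "(\<Sum>b\<in>B. c b *\<^sub>R b) = 0"
    proof (rule inj)
      show "(\<Sum>b\<in>B. c b *\<^sub>R b) \<in> V" using B(1) by (intro subspace_sum[OF V] subspace_scale[OF V]) auto
      show "l i (\<Sum>b\<in>B. c b *\<^sub>R b) = 0" if "i \<in> I" for i using comb[OF that] c(2) that by auto
    qed
    then show False using B(2) c(1) finB by (auto simp: independent_explicit_finite_subsets)
  qed
  moreover have "card I \<le> card B"
  proof (rule ccontr)
    assume "\<not> ?thesis"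
    then obtain c where c: "\<exists>i\<in>I. c i \<noteq> 0" "\<forall>b\<in>B. (\<Sum>i\<in>I. c i * l i b) = 0"
      using homogeneous_system_nontrivial[OF I finB, of l] by auto
    have "(\<Sum>i\<in>I. c i * l i x) = 0" if x: "x \<in> V" for x
    proof -
      obtain d where d: "x = (\<Sum>b\<in>B. d b *\<^sub>R b)"
        using x spanB span_finite[OF finB] by auto
      have "(\<Sum>i\<in>I. c i * l i x) = (\<Sum>i\<in>I. \<Sum>b\<in>B. d b * (c i * l i b))"
        unfolding d using comb by (intro sum.cong) (auto simp: sum_distrib_left mult.left_commute)
      also have "\<dots> = (\<Sum>b\<in>B. d b * (\<Sum>i\<in>I. c i * l i b))"
        by (subst sum.swap) (simp add: sum_distrib_left)
      also have "\<dots> = 0" using c(2) by simp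
      finally show ?thesis .
    qed
    then show False using c(1) indep by blast
  qed
  ultimately show ?thesis
    unfolding unisolvent_def using I B(4) inj by auto
qed

text \<open>The basis of \<open>W\<close> gives as many equations as there are basis vectors. Allowing a multiple of \<open>l\<close> as
  an additional unknown forces a nontrivial solution of the homogeneous system, and definiteness
  of \<open>\<beta>\<close> excludes that this multiple is zero.\<close>

lemma riesz_finite_span:
  fixes W :: "'v::real_vector set" and \<beta> :: "'v \<Rightarrow> 'v \<Rightarrow> real"
  assumes W: "W = span S" "finite S"
    and add: "\<And>x y z. x \<in> W \<Longrightarrow> y \<in> W \<Longrightarrow> z \<in> W \<Longrightarrow> \<beta> (x + y) z = \<beta> x z + \<beta> y z"
    and scale: "\<And>c x z. x \<in> W \<Longrightarrow> z \<in> W \<Longrightarrow> \<beta> (c *\<^sub>R x) z = c * \<beta> x z"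
    and sym: "\<And>x y. \<beta> x y = \<beta> y x"
    and pos: "\<And>x. x \<in> W \<Longrightarrow> \<beta> x x = 0 \<Longrightarrow> x = 0"
    and l_add: "\<And>x y. x \<in> W \<Longrightarrow> y \<in> W \<Longrightarrow> l (x + y) = l x + l y"
    and l_scale: "\<And>c x. x \<in> W \<Longrightarrow> l (c *\<^sub>R x) = c * l x"
  shows "\<exists>w\<in>W. \<forall>z\<in>W. \<beta> w z = l z"
proof -
  obtain B where B: "B \<subseteq> S" "independent B" "S \<subseteq> span B"
    using maximal_independent_subset by blast
  have finB: "finite B" using B(1) W(2) by (rule finite_subset)
  have WB: "W = span B"
    using W(1) B(1,3) span_mono span_minimal[OF B(3) subspace_span] by blast
  have W_sub: "subspace W" by (simp add: W)
  have B_in_W: "B \<subseteq> W" using WB span_superset by blast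
  define a where "a i z = (case i of None \<Rightarrow> l z | Some b \<Rightarrow> \<beta> b z)" for i z
  define I where "I = insert None (Some ` B)"
  have "finite I" "card B < card I" using finB by (auto simp: I_def card_image)
  then obtain c where c: "\<exists>i\<in>I. c i \<noteq> 0" "\<forall>z\<in>B. (\<Sum>i\<in>I. c i * a i z) = 0"
    using homogeneous_system_nontrivial[of I B a] finB by blast
  define w where "w = (\<Sum>b\<in>B. c (Some b) *\<^sub>R b)"
  have comb: "(\<Sum>b\<in>A. d b *\<^sub>R b) \<in> W \<and> \<beta> (\<Sum>b\<in>A. d b *\<^sub>R b) z = (\<Sum>b\<in>A. d b * \<beta> b z)"
    if A: "A \<subseteq> B" and z: "z \<in> W" for A d z
    using finite_subset[OF A finB] A
  proof (induction A rule: finite_induct)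
    case empty
    then show ?case using subspace_0[OF W_sub] scale[of 0 z 0] z by simp
  next
    case (insert b A)
    then have "b \<in> W" using B_in_W by blast
    then have "d b *\<^sub>R b \<in> W" by (rule subspace_scale[OF W_sub])
    then show ?case using insert add z scale[OF \<open>b \<in> W\<close> z] subspace_add[OF W_sub] by simp
  qed
  have wW: "w \<in> W" using comb[OF order_refl subspace_0[OF W_sub]] by (simp add: w_def)
  have sum0: "\<beta> w z + c None * l z = 0" if "z \<in> B" for z
  proof -
    have "(\<Sum>i\<in>I. c i * a i z) = c None * l z + (\<Sum>b\<in>B. c (Some b) * \<beta> b z)"
      using finB by (simp add: I_def a_def sum.reindex)
    then show ?thesis using c(2) that comb[of B z] B_in_W by (auto simp: w_def)
  qed
  have "z \<in> W \<and> \<beta> w z + c None * l z = 0" if "z \<in> span B" for z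
    using that
  proof (induction rule: span_induct_alt)
    case base
    show ?case
      using scale[of 0 w 0] l_scale[of 0 0] sym[of w 0] wW subspace_0[OF W_sub] by simp
  next
    case (step r x y)
    then have x: "x \<in> W" "y \<in> W" using B_in_W by auto
    then have "\<beta> w (r *\<^sub>R x + y) = r * \<beta> w x + \<beta> w y"
      using add[of "r *\<^sub>R x" y w] scale[of x w r] wW subspace_scale[OF W_sub] sym by simp
    moreover have "l (r *\<^sub>R x + y) = r * l x + l y"
      using l_add[of "r *\<^sub>R x" y] l_scale[of x r] x subspace_scale[OF W_sub] by simp
    ultimately have "\<beta> w (r *\<^sub>R x + y) + c None * l (r *\<^sub>R x + y)
        = r * (\<beta> w x + c None * l x) + (\<beta> w y + c None * l y)"
      by (simp add: algebra_simps)
    then show ?case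
      using sum0[OF step(1)] step x subspace_add[OF W_sub] subspace_scale[OF W_sub] by simp
  qed
  then have sum0': "\<beta> w z + c None * l z = 0" if "z \<in> W" for z
    using that unfolding WB by blast
  have c0: "c None \<noteq> 0"
  proof
    assume c0: "c None = 0"
    then have "w = 0" using sum0'[OF wW] pos[OF wW] by simp
    then have "c (Some b) = 0" if "b \<in> B" for b
      using independentD[OF B(2) finB order_refl _ that, of "\<lambda>b. c (Some b)"] by (simp add: w_def)
    then show False using c(1) c0 by (auto simp: I_def)
  qed
  have "\<beta> ((- 1 / c None) *\<^sub>R w) z = l z" if "z \<in> W" for z
  proof -
    have "\<beta> w z = - (c None * l z)" using sum0'[OF that] by simp
    then show ?thesis unfolding scale[OF wW that] using c0 by simp
  qed
  then show ?thesis using subspace_scale[OF W_sub wW, of "- 1 / c None"] by blast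
qed

section \<open>Tangential-normal components on a simplex\<close>

locale framed_simplex =
  fixes T :: "(real^'n) set" and t :: "(real^'n) set \<Rightarrow> nat \<Rightarrow> real^'n"
  assumes dim_ge_2: "CARD('n) \<ge> 2"
    and simplex_T: "int CARD('n) simplex T"
    and tangents: "\<And>F. F facet_of T \<Longrightarrow> orthonormal_tangent_basis F (t F)"
begin

abbreviation "normal F \<equiv> outward_normal T F"

abbreviation tn :: "(real^'n) set \<Rightarrow> nat \<Rightarrow> real^'n^'n \<Rightarrow> real" where
  "tn F i A \<equiv> t F i \<bullet> (A *v normal F)"

text \<open>On the simplex this is the distance to the hyperplane of \<open>F\<close>. It is independent of the point chosen
  in \<open>F\<close>, because \<open>normal F\<close> is orthogonal to the differences of points of \<open>F\<close>.\<close>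

definition height :: "(real^'n) set \<Rightarrow> real^'n \<Rightarrow> real" where
  "height F x = - normal F \<bullet> x + normal F \<bullet> (SOME y. y \<in> F)"

lemma ex_barycentric: "\<exists>C g b. barycentric_simplex T C g b"
proof -
  obtain C where C: "\<not> affine_dependent C" "int (card C) = int CARD('n) + 1" "T = convex hull C"
    using simplex_T unfolding simplex_def by blast
  obtain g b where "\<forall>u\<in>C. \<forall>v\<in>C. g u \<bullet> v + b u = (if u = v then 1 else 0)"
    using simplex_barycentric_gradients[OF C(1)] by blast
  then have "barycentric_simplex T C g b"
    using C dim_ge_2 by unfold_locales auto
  then show ?thesis by blast
qed

lemma simplex_body: "compact T" "convex T" "interior T \<noteq> {}"
proof -
  obtain C g b where "barycentric_simplex T C g b" using ex_barycentric by blast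
  then interpret barycentric_simplex T C g b .
  show "compact T" "convex T"
    unfolding T_eq using finite_C by (auto intro: compact_convex_hull finite_imp_compact)
  have "affine hull T = UNIV" by (simp add: T_eq affine_hull_C)
  moreover have "T \<noteq> {}" using ex_other_vertex T_eq by auto
  ultimately show "interior T \<noteq> {}"
    using rel_interior_interior[of T] rel_interior_eq_empty[OF \<open>convex T\<close>] by simp
qed

lemma finite_facets: "finite {F. F facet_of T}"
proof -
  obtain C g b where "barycentric_simplex T C g b" using ex_barycentric by blast
  then interpret barycentric_simplex T C g b .
  have "{F. F facet_of T} = (\<lambda>u. convex hull (C - {u})) ` C" by (auto simp: facet_iff)
  then show ?thesis using finite_C by simp
qed

context
  fixes F assumes F: "F facet_of T"
begin

lemma facet_body: "compact F" "convex F" "F \<noteq> {}" "F \<subseteq> T"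
proof -
  have face: "F face_of T" using F facet_of_imp_face_of by blast
  show "compact F" using face_of_imp_compact[OF simplex_body(2,1) face] .
  show "convex F" using face_of_imp_convex[OF face] .
  show "F \<noteq> {}" using F by (auto simp: facet_of_def)
  show "F \<subseteq> T" using face_of_imp_subset[OF face] .
qed

lemma norm_normal: "norm (normal F) = 1"
  and tangent_space_eq: "tangent_space F = {w. normal F \<bullet> w = 0}"
  and affine_hull_eq: "affine hull F = {x. height F x = 0}"
  and height_nonneg: "x \<in> T \<Longrightarrow> height F x \<ge> 0"
  and ex_height_pos: "\<exists>x\<in>T. height F x > 0"
proof -
  obtain C g b where "barycentric_simplex T C g b" using ex_barycentric by blast
  then interpret barycentric_simplex T C g b .
  obtain u where u: "u \<in> C" "F = convex hull (C - {u})" using F facet_iff by blast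
  define c where "c = 1 / norm (g u)"
  have c: "c > 0" using gradient_nonzero[OF u(1)] by (simp add: c_def)
  have n: "normal F = - c *\<^sub>R g u"
    using outward_normal_facet[OF u(1)] u(2) by (simp add: c_def)
  show "norm (normal F) = 1" using gradient_nonzero[OF u(1)] by (simp add: n c_def)
  show "tangent_space F = {w. normal F \<bullet> w = 0}"
    unfolding n using tangent_space_facet[OF u(1), folded u(2)] c by simp
  have "(SOME y. y \<in> F) \<in> F" using facet_body(3) by (simp add: some_in_eq)
  then have "bary u (SOME y. y \<in> F) = 0" using mem_facet_iff[OF u(1), folded u(2)] by simp
  then have "b u = - (g u \<bullet> (SOME y. y \<in> F))" by (simp add: bary_def)
  then have h: "height F x = c * bary u x" for x
    unfolding height_def n bary_def by (simp add: algebra_simps)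
  show "affine hull F = {x. height F x = 0}"
    using affine_hull_facet[OF u(1), folded u(2)] c by (simp add: h)
  show "height F x \<ge> 0" if "x \<in> T"
    using that mem_simplex_iff u(1) c by (simp add: h)
  have "u \<in> T" using u(1) T_eq by (auto intro: hull_inc)
  moreover have "height F u > 0" using bary_vertex[OF u(1) u(1)] c by (simp add: h)
  ultimately show "\<exists>x\<in>T. height F x > 0" by blast
qed

lemma height_eq_0: "x \<in> F \<Longrightarrow> height F x = 0"
  using affine_hull_eq hull_inc[of x F affine] by simp

lemma continuous_on_height: "continuous_on S (height F)"
  unfolding height_def[abs_def] by (intro continuous_intros)

lemma ex_traceless_with_normal_trace:
  assumes s: "normal F \<bullet> s = 0"
  shows "\<exists>\<phi>. trace \<phi> = 0 \<and> (\<exists>\<alpha>. \<phi> *v normal F = s + \<alpha> *\<^sub>R normal F) \<and>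
    (\<forall>F'. F' facet_of T \<and> F' \<noteq> F \<longrightarrow> (\<exists>\<alpha>. \<phi> *v normal F' = \<alpha> *\<^sub>R normal F'))"
proof -
  obtain C g b where "barycentric_simplex T C g b" using ex_barycentric by blast
  then interpret barycentric_simplex T C g b .
  obtain u where u: "u \<in> C" "F = convex hull (C - {u})" using F facet_iff by blast
  have n: "normal (convex hull (C - {v})) = - (1 / norm (g v)) *\<^sub>R g v" if "v \<in> C" for v
    using outward_normal_facet[OF that] .
  have nu: "norm (g u) \<noteq> 0" using gradient_nonzero[OF u(1)] by simp
  have "g u \<bullet> (- norm (g u) *\<^sub>R s) = 0"
    using s nu unfolding u(2) n[OF u(1)] by simp
  then obtain \<phi> \<alpha> where \<phi>: "trace \<phi> = 0" "\<phi> *v g u = - norm (g u) *\<^sub>R s + \<alpha> *\<^sub>R g u"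
      "\<forall>v\<in>C. v \<noteq> u \<longrightarrow> (\<exists>\<alpha>. \<phi> *v g v = \<alpha> *\<^sub>R g v)"
    using ex_traceless_with_normal_image[OF u(1), of "- norm (g u) *\<^sub>R s"] by blast
  have "\<phi> *v normal F = - (1 / norm (g u)) *\<^sub>R (- norm (g u) *\<^sub>R s + \<alpha> *\<^sub>R g u)"
    by (simp only: u(2) n[OF u(1)] matrix_vector_mult_scaleR \<phi>(2))
  also have "\<dots> = s + \<alpha> *\<^sub>R normal F"
    unfolding u(2) n[OF u(1)] using nu
    by (simp add: scaleR_add_right scaleR_diff_right)
  finally have "\<phi> *v normal F = s + \<alpha> *\<^sub>R normal F" .
  moreover have "\<exists>\<alpha>. \<phi> *v normal F' = \<alpha> *\<^sub>R normal F'" if "F' facet_of T" "F' \<noteq> F" for F'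
  proof -
    obtain v where v: "v \<in> C" "F' = convex hull (C - {v})" using \<open>F' facet_of T\<close> facet_iff by blast
    then have "v \<noteq> u" using that u by auto
    then obtain \<beta> where "\<phi> *v g v = \<beta> *\<^sub>R g v" using \<phi>(3) v by blast
    then have "\<phi> *v normal F' = \<beta> *\<^sub>R normal F'"
      unfolding v(2) n[OF v(1)] matrix_vector_mult_scaleR by (simp add: mult.commute)
    then show ?thesis by blast
  qed
  ultimately show ?thesis using \<phi>(1) by (intro exI[of _ \<phi>]) auto
qed

lemma tangent_orthonormal:
  assumes "i \<in> {1..CARD('n) - 1}" "j \<in> {1..CARD('n) - 1}"
  shows "t F i \<bullet> t F j = (if i = j then 1 else 0)"
  using tangents[OF F] assms by (simp add: orthonormal_tangent_basis_def)

lemma normal_tangent: assumes "i \<in> {1..CARD('n) - 1}" shows "normal F \<bullet> t F i = 0"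
proof -
  have "t F i \<in> span (t F ` {1..CARD('n) - 1})" using assms by (intro span_base) auto
  then show ?thesis
    using tangents[OF F] tangent_space_eq by (auto simp: orthonormal_tangent_basis_def)
qed

text \<open>A vector is a multiple of the normal if and only if it is orthogonal to the tangent basis. Bubbles
  are defined by the tangential part; in the sequel they are handled through the components \<open>tn\<close>.\<close>

lemma tangential_part_eq_0_iff:
  "(\<forall>i\<in>{1..CARD('n) - 1}. tn F i A = 0) \<longleftrightarrow> A *v normal F = (normal F \<bullet> (A *v normal F)) *\<^sub>R normal F"
proof
  assume A: "\<forall>i\<in>{1..CARD('n) - 1}. tn F i A = 0"
  define w where "w = A *v normal F - (normal F \<bullet> (A *v normal F)) *\<^sub>R normal F"
  have nn: "normal F \<bullet> normal F = 1" using norm_normal by (simp add: norm_eq_1)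
  then have "normal F \<bullet> w = 0" by (simp add: w_def inner_diff_right)
  then have "w \<in> span (t F ` {1..CARD('n) - 1})"
    using tangents[OF F] tangent_space_eq by (auto simp: orthonormal_tangent_basis_def)
  moreover have "orthogonal w x" if x: "x \<in> t F ` {1..CARD('n) - 1}" for x
  proof -
    from x obtain i where i: "i \<in> {1..CARD('n) - 1}" "x = t F i" by blast
    have "t F i \<bullet> w = 0"
      using A i normal_tangent[OF i(1)] by (simp add: w_def inner_diff_right inner_commute)
    then show ?thesis using i by (simp add: orthogonal_def inner_commute)
  qed
  ultimately have "orthogonal w w" using orthogonal_to_span by blast
  then show "A *v normal F = (normal F \<bullet> (A *v normal F)) *\<^sub>R normal F"
    by (simp add: orthogonal_def w_def)
next
  assume A: "A *v normal F = (normal F \<bullet> (A *v normal F)) *\<^sub>R normal F"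
  show "\<forall>i\<in>{1..CARD('n) - 1}. tn F i A = 0"
    by (subst A) (simp add: normal_tangent inner_commute)
qed

end

lemma tn_add: "tn F i (A + B) = tn F i A + tn F i B"
  by (simp add: matrix_vector_mult_add_rdistrib inner_add_right)

lemma tn_scale: "tn F i (c *\<^sub>R A) = c * tn F i A"
  by (simp add: scaleR_matrix_vector_assoc[symmetric])

lemma tn_diff: "tn F i (A - B) = tn F i A - tn F i B"
  by (simp add: matrix_vector_mult_diff_rdistrib inner_diff_right)

lemma tn_sum: "tn F i (sum f I) = (\<Sum>j\<in>I. tn F i (f j))"
  by (simp add: matrix_vector_mult_sum_left inner_sum_right)

lemma tn_eq_inner_dyad: "tn F i A = A \<bullet> dyad (t F i) (normal F)"
  by (simp add: inner_dyad)

lemma traceless_eq_0_if_tn_eq_0: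
  assumes "trace A = 0" and tn: "\<And>F i. F facet_of T \<Longrightarrow> i \<in> {1..CARD('n) - 1} \<Longrightarrow> tn F i A = 0"
  shows "A = 0"
proof -
  obtain C g b where "barycentric_simplex T C g b" using ex_barycentric by blast
  then interpret barycentric_simplex T C g b .
  show ?thesis
  proof (rule traceless_normal_normal_zero[OF assms(1)])
    fix u assume u: "u \<in> C"
    define F where "F = convex hull (C - {u})"
    have F: "F facet_of T" using u facet_iff F_def by blast
    have "A *v normal F = (normal F \<bullet> (A *v normal F)) *\<^sub>R normal F"
      using tangential_part_eq_0_iff[OF F] tn[OF F] by blast
    moreover have g: "g u = - norm (g u) *\<^sub>R normal F"
      using outward_normal_facet[OF u] gradient_nonzero[OF u] by (simp add: F_def)
    ultimately have "A *v g u = (normal F \<bullet> (A *v normal F)) *\<^sub>R g u"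
      by (metis matrix_vector_mult_scaleR scaleR_left_commute)
    then show "\<exists>c. A *v g u = c *\<^sub>R g u" by blast
  qed
qed

text \<open>By \<open>ex_traceless_with_normal_trace\<close> there is a traceless matrix that maps the normal of \<open>F\<close> to
  \<open>t F i\<close> up to a multiple of that normal and has all the other normals as eigenvectors; multiples
  of the normal are invisible to the tangent vectors.\<close>

lemma ex_dual_mat:
  "\<exists>\<phi>. \<forall>F i. F facet_of T \<longrightarrow> i \<in> {1..CARD('n) - 1} \<longrightarrow> trace (\<phi> F i) = 0 \<and>
     (\<forall>F' j. F' facet_of T \<longrightarrow> j \<in> {1..CARD('n) - 1} \<longrightarrow>
        tn F' j (\<phi> F i) = (if F' = F \<and> j = i then 1 else 0))"
proof -
  have "\<exists>\<phi>. trace \<phi> = 0 \<and> (\<forall>F' j. F' facet_of T \<longrightarrow> j \<in> {1..CARD('n) - 1} \<longrightarrow>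
        tn F' j \<phi> = (if F' = F \<and> j = i then 1 else 0))"
    if F: "F facet_of T" and i: "i \<in> {1..CARD('n) - 1}" for F i
  proof -
    obtain \<phi> \<alpha> where \<phi>: "trace \<phi> = 0" "\<phi> *v normal F = t F i + \<alpha> *\<^sub>R normal F"
        "\<forall>F'. F' facet_of T \<and> F' \<noteq> F \<longrightarrow> (\<exists>\<alpha>. \<phi> *v normal F' = \<alpha> *\<^sub>R normal F')"
      using ex_traceless_with_normal_trace[OF F normal_tangent[OF F i]] by blast
    have "tn F' j \<phi> = (if F' = F \<and> j = i then 1 else 0)"
      if F': "F' facet_of T" and j: "j \<in> {1..CARD('n) - 1}" for F' j
    proof (cases "F' = F")
      case True
      then show ?thesis
        using \<phi>(2) normal_tangent[OF F j] tangent_orthonormal[OF F j i]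
        by (simp add: inner_add_right inner_commute)
    next
      case False
      then obtain \<beta> where "\<phi> *v normal F' = \<beta> *\<^sub>R normal F'" using \<phi>(3) F' by blast
      then show ?thesis using False normal_tangent[OF F' j] by (simp add: inner_commute)
    qed
    then show ?thesis using \<phi>(1) by blast
  qed
  then show ?thesis by metis
qed

definition dual_mat :: "(real^'n) set \<Rightarrow> nat \<Rightarrow> real^'n^'n" where
  "dual_mat = (SOME \<phi>. \<forall>F i. F facet_of T \<longrightarrow> i \<in> {1..CARD('n) - 1} \<longrightarrow> trace (\<phi> F i) = 0 \<and>
     (\<forall>F' j. F' facet_of T \<longrightarrow> j \<in> {1..CARD('n) - 1} \<longrightarrow>
        tn F' j (\<phi> F i) = (if F' = F \<and> j = i then 1 else 0)))"

lemma trace_dual_mat: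
  "F facet_of T \<Longrightarrow> i \<in> {1..CARD('n) - 1} \<Longrightarrow> trace (dual_mat F i) = 0"
  and tn_dual_mat:
  "F facet_of T \<Longrightarrow> i \<in> {1..CARD('n) - 1} \<Longrightarrow> F' facet_of T \<Longrightarrow> j \<in> {1..CARD('n) - 1} \<Longrightarrow>
     tn F' j (dual_mat F i) = (if F' = F \<and> j = i then 1 else 0)"
  using someI_ex[OF ex_dual_mat] unfolding dual_mat_def[symmetric] by blast+

lemma tn_dual_mat_combination:
  assumes F: "F facet_of T" and i: "i \<in> {1..CARD('n) - 1}"
  shows "tn F i (\<Sum>F' | F' facet_of T. \<Sum>j\<in>{1..CARD('n) - 1}. c F' j *\<^sub>R dual_mat F' j) = c F i"
proof -
  have "tn F i (\<Sum>F' | F' facet_of T. \<Sum>j\<in>{1..CARD('n) - 1}. c F' j *\<^sub>R dual_mat F' j)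
      = (\<Sum>F' | F' facet_of T. \<Sum>j\<in>{1..CARD('n) - 1}. c F' j * tn F i (dual_mat F' j))"
    by (simp only: tn_sum tn_scale)
  also have "\<dots> = (\<Sum>F' | F' facet_of T. \<Sum>j\<in>{1..CARD('n) - 1}. if j = i then if F' = F then c F i else 0 else 0)"
    using tn_dual_mat[OF _ _ F i] by (intro sum.cong refl) auto
  also have "\<dots> = c F i"
    using finite_facets F i by simp
  finally show ?thesis .
qed

text \<open>Both sides have the same tangential-normal components, and these determine a traceless matrix.\<close>

lemma traceless_expansion:
  assumes "trace A = 0"
  shows "(\<Sum>F | F facet_of T. \<Sum>i\<in>{1..CARD('n) - 1}. tn F i A *\<^sub>R dual_mat F i) = A"
proof -
  let ?E = "\<Sum>F | F facet_of T. \<Sum>i\<in>{1..CARD('n) - 1}. tn F i A *\<^sub>R dual_mat F i"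
  have "?E - A = 0"
  proof (rule traceless_eq_0_if_tn_eq_0)
    show "trace (?E - A) = 0"
      using assms by (simp add: trace_sub trace_sum trace_scaleR trace_dual_mat)
    show "tn F i (?E - A) = 0" if "F facet_of T" "i \<in> {1..CARD('n) - 1}" for F i
      unfolding tn_diff tn_dual_mat_combination[OF that] by simp
  qed
  then show ?thesis by simp
qed

end

section \<open>Bubbles and prescribed moments\<close>

context framed_simplex
begin

lemma full_support_T: "full_support lborel T"
  using full_support_lborel[OF simplex_body] .

lemma full_support_facet: "F facet_of T \<Longrightarrow> full_support (surface_measure F) F"
  using full_support_surface_measure facet_body(1-3) tangents by blast

lemma continuous_on_traceless_polys:
  "\<tau> \<in> mat_polys m T traceless_mats \<Longrightarrow> continuous_on T \<tau>"
  using continuous_on_mat_polys[OF subspace_traceless_mats] .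

lemma trace_eq_0:
  assumes "\<tau> \<in> mat_polys m T traceless_mats" shows "trace (\<tau> x) = 0"
proof -
  have "\<tau> x \<in> traceless_mats" using assms by (simp add: mat_polys_iff[OF subspace_traceless_mats])
  then show ?thesis by (simp add: traceless_mats_def)
qed

lemma tn_in_polys:
  "\<tau> \<in> mat_polys m T traceless_mats \<Longrightarrow> (\<lambda>x. tn F i (\<tau> x)) \<in> polys m T"
  by (simp add: tn_eq_inner_dyad mat_polys_iff[OF subspace_traceless_mats])

lemma inner_in_polys:
  "\<tau> \<in> mat_polys m T traceless_mats \<Longrightarrow> (\<lambda>x. A \<bullet> \<tau> x) \<in> polys m T"
  by (simp add: inner_commute[of A] mat_polys_iff[OF subspace_traceless_mats])

lemma bubble_tn_iff:
  "\<beta> \<in> bubble_tn m T \<longleftrightarrow> \<beta> \<in> mat_polys m T traceless_mats \<and>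
     (\<forall>F i x. F facet_of T \<longrightarrow> i \<in> {1..CARD('n) - 1} \<longrightarrow> x \<in> F \<longrightarrow> tn F i (\<beta> x) = 0)"
proof -
  have "tangential_proj (normal F) *v (\<beta> x *v normal F) = 0 \<longleftrightarrow> (\<forall>i\<in>{1..CARD('n) - 1}. tn F i (\<beta> x) = 0)"
    if "F facet_of T" for F x
    using tangential_part_eq_0_iff[OF that, of "\<beta> x"] by (simp add: tangential_proj_mult)
  then show ?thesis unfolding bubble_tn_def by blast
qed

lemma subspace_bubble_tn: "subspace (bubble_tn m T)"
proof -
  note [simp] = subspace_mat_polys[of m T traceless_mats]
  have [simp]: "(c *\<^sub>R \<tau>) x = c *\<^sub>R \<tau> x" for c x and \<tau> :: "real^'n \<Rightarrow> real^'n^'n"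
    by (simp add: scaleR_fun_def)
  show ?thesis
    by (rule subspaceI)
       (auto simp: bubble_tn_iff subspace_0 subspace_add subspace_scale tn_add tn_scale)
qed

lemma Sigma_plus_subset: "Sigma_plus k T \<subseteq> mat_polys (k + 1) T traceless_mats"
proof
  fix \<tau> assume "\<tau> \<in> Sigma_plus k T"
  then obtain \<sigma> \<beta> where *: "\<tau> = \<sigma> + \<beta>" "\<sigma> \<in> mat_polys k T traceless_mats" "\<beta> \<in> bubble_tn (k + 1) T"
    unfolding Sigma_plus_def by blast
  moreover have "\<sigma> \<in> mat_polys (k + 1) T traceless_mats"
    using *(2) mat_polys_mono[OF subspace_traceless_mats, of k "k + 1"] by auto
  ultimately show "\<tau> \<in> mat_polys (k + 1) T traceless_mats"
    by (auto simp: bubble_tn_iff intro: subspace_add[OF subspace_mat_polys])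
qed

lemma subspace_Sigma_plus: "subspace (Sigma_plus k T)"
  unfolding Sigma_plus_def by (intro subspace_sums subspace_mat_polys subspace_bubble_tn)

lemma continuous_on_Sigma_plus: "\<tau> \<in> Sigma_plus k T \<Longrightarrow> continuous_on T \<tau>"
  using Sigma_plus_subset continuous_on_traceless_polys by blast

lemma subspace_Sigma_plus_sym: "subspace (Sigma_plus_sym k T)"
proof (rule subspaceI)
  show "0 \<in> Sigma_plus_sym k T"
    using subspace_0[OF subspace_Sigma_plus] L2_inner_zero_left[OF full_support_T]
    by (auto simp: Sigma_plus_sym_def)
next
  fix \<sigma> \<tau> assume *: "\<sigma> \<in> Sigma_plus_sym k T" "\<tau> \<in> Sigma_plus_sym k T"
  then have "continuous_on T \<sigma>" "continuous_on T \<tau>"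
    using continuous_on_Sigma_plus[of _ k] by (auto simp: Sigma_plus_sym_def)
  then have "L2_inner lborel T (\<sigma> + \<tau>) q = 0" if "q \<in> mat_polys k T skew_mats" for q
    using L2_inner_add_left[OF full_support_T, of \<sigma> \<tau> q] that *
      continuous_on_mat_polys[OF subspace_skew_mats that]
    by (simp add: Sigma_plus_sym_def)
  then show "\<sigma> + \<tau> \<in> Sigma_plus_sym k T"
    using * subspace_add[OF subspace_Sigma_plus] by (simp add: Sigma_plus_sym_def)
next
  fix c \<tau> assume "\<tau> \<in> Sigma_plus_sym k T"
  then show "c *\<^sub>R \<tau> \<in> Sigma_plus_sym k T"
    using subspace_scale[OF subspace_Sigma_plus, of \<tau> k c]
    by (simp add: Sigma_plus_sym_def L2_inner_scale_left[OF full_support_T])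
qed

text \<open>Elements of \<open>Sigma_plus k T\<close> may have degree \<open>k + 1\<close>, but the bubble part, which alone reaches this
  degree, has no tangential-normal trace. Hence the traces may be used as test functions in the
  facet degrees of freedom.\<close>

lemma tn_trace_in_polys:
  assumes \<tau>: "\<tau> \<in> Sigma_plus k T" and F: "F facet_of T" and i: "i \<in> {1..CARD('n) - 1}"
  shows "zero_ext F (\<lambda>x. tn F i (\<tau> x)) \<in> polys k F"
proof -
  obtain \<sigma> \<beta> where *: "\<tau> = \<sigma> + \<beta>" "\<sigma> \<in> mat_polys k T traceless_mats" "\<beta> \<in> bubble_tn (k + 1) T"
    using \<tau> unfolding Sigma_plus_def by blast
  then have "tn F i (\<tau> x) = tn F i (\<sigma> x)" if "x \<in> F" for x
    using that F i by (simp add: tn_add bubble_tn_iff)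
  then have "zero_ext F (\<lambda>x. tn F i (\<tau> x)) = zero_ext F (\<lambda>x. tn F i (\<sigma> x))" by auto
  then show ?thesis
    using polys_restrict[OF tn_in_polys[OF *(2), of F i] facet_body(4)[OF F]] by simp
qed

text \<open>The height is positive on a nonempty open part of the simplex, and a polynomial that vanishes on a
  nonempty open set is zero. This gives definiteness of the weighted inner product used below.\<close>

lemma polys_eq_0_if_height_times_eq_0:
  assumes F: "F facet_of T" and p: "p \<in> polys m T"
    and zero: "\<And>x. x \<in> T \<Longrightarrow> height F x * p x = 0"
  shows "p = 0"
proof -
  obtain P where P: "P \<in> polys m UNIV" "p = zero_ext T P" using p polys_iff_extension by blast
  define U where "U = interior T \<inter> {x. height F x > 0}"
  have half: "{x. height F x > 0} = {x. normal F \<bullet> x < normal F \<bullet> (SOME y. y \<in> F)}"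
    by (auto simp: height_def)
  have U: "open U" "convex U"
    unfolding U_def half
    by (auto intro!: open_Int open_halfspace_lt convex_Int convex_interior simplex_body convex_halfspace_lt)
  obtain v where v: "v \<in> T" "height F v > 0" using ex_height_pos[OF F] by blast
  have "v \<in> closure (interior T)"
    using convex_closure_interior[OF simplex_body(2,3)] closure_subset v(1) by blast
  moreover have "open {x. height F x > 0}" unfolding half by (rule open_halfspace_lt)
  ultimately have "U \<noteq> {}"
    using v(2) open_Int_closure_eq_empty[of "{x. height F x > 0}" "interior T"] by (auto simp: U_def)
  then have "P x = 0" for x
  proof (rule polys_zero_on_affine_hull[OF P(1) U(2)])
    show "P x = 0" if "x \<in> U" for x
      using that zero[of x] P(2) interior_subset[of T] by (auto simp: U_def)
    show "x \<in> affine hull U" using affine_hull_open[OF U(1) \<open>U \<noteq> {}\<close>] by simp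
  qed
  then show ?thesis using P(2) by auto
qed

lemma vanishing_trace_divisible:
  assumes F: "F facet_of T" and p: "p \<in> polys (Suc m) T" and zero: "\<And>x. x \<in> F \<Longrightarrow> p x = 0"
  shows "\<exists>r\<in>polys m T. \<forall>x\<in>T. p x = height F x * r x"
  unfolding height_def
proof (rule polys_vanishing_on_face_divisible[OF p facet_body(2-4)[OF F] _ _ zero])
  show "affine hull F = {x. - normal F \<bullet> x + normal F \<bullet> (SOME y. y \<in> F) = 0}"
    using affine_hull_eq[OF F] by (simp only: height_def)
  show "- normal F \<noteq> 0" using norm_normal[OF F] by auto
qed

text \<open>The Riesz representation of \<open>r \<mapsto> \<integral> h r\<close> with respect to the inner product
  \<open>(p, r) \<mapsto> \<integral> height F \<cdot> p r\<close>.\<close>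

lemma ex_poly_with_weighted_moments:
  assumes F: "F facet_of T" and h: "continuous_on T h"
  shows "\<exists>p\<in>polys k T. \<forall>r\<in>polys k T.
    L2_inner lborel T (\<lambda>x. height F x * p x) r = L2_inner lborel T h r"
proof -
  obtain S where S: "finite S" "polys k T = span S" using polys_finite_span by blast
  note cont = continuous_on_polys continuous_on_height[OF F] continuous_on_mult
  show ?thesis
  proof (rule riesz_finite_span[OF S(2,1)])
    fix p q r assume pqr: "p \<in> polys k T" "q \<in> polys k T" "r \<in> polys k T"
    have "(\<lambda>x. height F x * (p + q) x) = (\<lambda>x. height F x * p x) + (\<lambda>x. height F x * q x)"
      by (simp add: fun_eq_iff distrib_left)
    then show "L2_inner lborel T (\<lambda>x. height F x * (p + q) x) r =
        L2_inner lborel T (\<lambda>x. height F x * p x) r + L2_inner lborel T (\<lambda>x. height F x * q x) r"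
      using pqr by (simp add: L2_inner_add_left[OF full_support_T] cont del: plus_fun_apply)
  next
    fix c p r
    have "(\<lambda>x. height F x * (c *\<^sub>R p) x) = c *\<^sub>R (\<lambda>x. height F x * p x)"
      by (simp add: fun_eq_iff scaleR_fun_def)
    then show "L2_inner lborel T (\<lambda>x. height F x * (c *\<^sub>R p) x) r =
        c * L2_inner lborel T (\<lambda>x. height F x * p x) r"
      by (simp add: L2_inner_scale_left[OF full_support_T])
  next
    show "L2_inner lborel T (\<lambda>x. height F x * p x) r = L2_inner lborel T (\<lambda>x. height F x * r x) p" for p r
      by (rule L2_inner_cong) simp
  next
    fix p assume p: "p \<in> polys k T" "L2_inner lborel T (\<lambda>x. height F x * p x) p = 0"
    have "height F x * p x * p x = 0" if "x \<in> T" for x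
    proof (rule full_support_integral_eq_0[OF full_support_T _ _ _ that])
      show "continuous_on T (\<lambda>x. height F x * p x * p x)" using p(1) by (intro cont)
      show "0 \<le> height F x * p x * p x" if "x \<in> T" for x
        using height_nonneg[OF F that] by (simp add: mult.assoc)
      show "(LINT x:T|lborel. height F x * p x * p x) = 0" using p(2) by (simp add: L2_inner_def)
    qed
    then show "p = 0" using polys_eq_0_if_height_times_eq_0[OF F p(1)] by simp
  next
    fix p q assume "p \<in> polys k T" "q \<in> polys k T"
    then show "L2_inner lborel T h (p + q) = L2_inner lborel T h p + L2_inner lborel T h q"
      using h by (simp add: L2_inner_add_right[OF full_support_T] cont)
  next
    show "L2_inner lborel T h (c *\<^sub>R p) = c * L2_inner lborel T h p" for c p
      by (rule L2_inner_scale_right[OF full_support_T])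
  qed
qed

text \<open>The component of \<open>\<beta>\<close> along \<open>\<phi> = dual_mat F i\<close> is \<open>height F \<cdot> p\<close>, which vanishes on \<open>F\<close>; this makes
  \<open>\<beta>\<close> a bubble. Here \<open>p\<close> is chosen such that \<open>height F \<cdot> p\<close> has the same moments as \<open>tn F i \<circ> g\<close>
  against all \<open>r\<close> of degree \<open>k\<close>, in particular against \<open>r = \<phi> \<bullet> q\<close>. Summing over \<open>(F, i)\<close> and using
  \<open>g = \<Sum> (tn F i \<circ> g) \<cdot> \<phi>\<close> gives the claim.\<close>

lemma ex_bubble_with_moments:
  assumes g: "g \<in> mat_polys m T traceless_mats"
  shows "\<exists>\<beta>\<in>bubble_tn (k + 1) T. \<forall>q\<in>mat_polys k T traceless_mats.
    L2_inner lborel T \<beta> q = L2_inner lborel T g q"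
proof -
  define good where "good F i p \<longleftrightarrow> p \<in> polys k T \<and> (\<forall>r\<in>polys k T.
      L2_inner lborel T (\<lambda>x. height F x * p x) r = L2_inner lborel T (\<lambda>x. tn F i (g x)) r)" for F i p
  have "\<exists>p. good F i p" if "F facet_of T" for F i
    using ex_poly_with_weighted_moments[OF that continuous_on_polys[OF tn_in_polys[OF g]]]
    unfolding good_def Bex_def .
  then obtain p where "\<And>F i. F facet_of T \<Longrightarrow> good F i (p F i)"
    by metis
  then have p: "\<And>F i. F facet_of T \<Longrightarrow> p F i \<in> polys k T"
    "\<And>F i r. F facet_of T \<Longrightarrow> r \<in> polys k T \<Longrightarrow>
      L2_inner lborel T (\<lambda>x. height F x * p F i x) r = L2_inner lborel T (\<lambda>x. tn F i (g x)) r"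
    unfolding good_def by blast+
  define b where "b F i = (\<lambda>x. (height F x * p F i x) *\<^sub>R dual_mat F i)" for F i
  define \<beta> where "\<beta> = (\<Sum>F | F facet_of T. \<Sum>i\<in>{1..CARD('n) - 1}. b F i)"
  have hp: "(\<lambda>x. height F x * p F i x) \<in> polys (Suc k) T" if "F facet_of T" for F i
    unfolding height_def using polys_times_affine_on[OF p(1)[OF that]] .
  have b: "b F i \<in> mat_polys (Suc k) T traceless_mats"
    if "F facet_of T" "i \<in> {1..CARD('n) - 1}" for F i
    unfolding b_def
    by (rule mat_polys_scale_poly[OF hp]) (use that in \<open>auto simp: traceless_mats_def trace_dual_mat\<close>)
  have \<beta>_poly: "\<beta> \<in> mat_polys (Suc k) T traceless_mats"
    unfolding \<beta>_def by (intro subspace_sum[OF subspace_mat_polys] b) auto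
  have \<beta>_apply: "\<beta> x = (\<Sum>F | F facet_of T. \<Sum>i\<in>{1..CARD('n) - 1}. (height F x * p F i x) *\<^sub>R dual_mat F i)" for x
    by (simp add: \<beta>_def b_def sum_fun_apply)
  have "\<beta> \<in> bubble_tn (k + 1) T"
    unfolding bubble_tn_iff
  proof (intro conjI allI impI)
    show "\<beta> \<in> mat_polys (k + 1) T traceless_mats" using \<beta>_poly by simp
    show "tn F i (\<beta> x) = 0" if "F facet_of T" "i \<in> {1..CARD('n) - 1}" "x \<in> F" for F i x
      unfolding \<beta>_apply tn_dual_mat_combination[OF that(1,2)] using height_eq_0[OF that(1,3)] by simp
  qed
  moreover have "L2_inner lborel T \<beta> q = L2_inner lborel T g q"
    if q: "q \<in> mat_polys k T traceless_mats" for q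
  proof -
    have cont_q: "continuous_on T q" using q continuous_on_traceless_polys by blast
    define e where "e F i = (\<lambda>x. tn F i (g x) *\<^sub>R dual_mat F i)" for F i
    have cont_e: "continuous_on T (e F i)" for F i
      unfolding e_def by (intro continuous_intros continuous_on_polys[OF tn_in_polys[OF g]])
    have g_eq: "g = (\<Sum>F | F facet_of T. \<Sum>i\<in>{1..CARD('n) - 1}. e F i)"
      using traceless_expansion[OF trace_eq_0[OF g]] by (simp add: fun_eq_iff sum_fun_apply e_def)
    have "L2_inner lborel T \<beta> q = (\<Sum>F | F facet_of T. \<Sum>i\<in>{1..CARD('n) - 1}. L2_inner lborel T (b F i) q)"
    proof -
      have "continuous_on T (b F i)" if "F \<in> {F. F facet_of T}" "i \<in> {1..CARD('n) - 1}" for F i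
        using b[of F i] that continuous_on_traceless_polys by blast
      then show ?thesis
        unfolding \<beta>_def by (rule L2_inner_double_sum_left[OF full_support_T cont_q])
    qed
    also have "\<dots> = (\<Sum>F | F facet_of T. \<Sum>i\<in>{1..CARD('n) - 1}. L2_inner lborel T (e F i) q)"
    proof (intro sum.cong refl)
      fix F i assume "F \<in> {F. F facet_of T}"
      then have F: "F facet_of T" by simp
      have "L2_inner lborel T (b F i) q
          = L2_inner lborel T (\<lambda>x. height F x * p F i x) (\<lambda>x. dual_mat F i \<bullet> q x)"
        by (rule L2_inner_cong) (simp add: b_def)
      also have "\<dots> = L2_inner lborel T (\<lambda>x. tn F i (g x)) (\<lambda>x. dual_mat F i \<bullet> q x)"
        by (rule p(2)[OF F inner_in_polys[OF q]])
      also have "\<dots> = L2_inner lborel T (e F i) q"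
        by (rule L2_inner_cong) (simp add: e_def)
      finally show "L2_inner lborel T (b F i) q = L2_inner lborel T (e F i) q" .
    qed
    also have "\<dots> = L2_inner lborel T g q"
      by (subst g_eq) (rule L2_inner_double_sum_left[OF full_support_T cont_q cont_e, symmetric])
    finally show ?thesis .
  qed
  ultimately show ?thesis by blast
qed

text \<open>A multiple of \<open>dual_mat F i\<close> by a polynomial extending \<open>Q\<close> has the required traces. Subtracting a
  bubble with the same moments does not change them and makes all moments vanish; in particular
  the moments against skew fields vanish, as membership in \<open>Sigma_plus_sym k T\<close> demands.\<close>

lemma ex_facet_dual:
  assumes F: "F facet_of T" and i: "i \<in> {1..CARD('n) - 1}" and Q: "Q \<in> polys k F"
  obtains \<tau> where "\<tau> \<in> Sigma_plus_sym k T" "\<And>x. x \<in> F \<Longrightarrow> tn F i (\<tau> x) = Q x"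
    "\<And>F' j x. F' facet_of T \<Longrightarrow> j \<in> {1..CARD('n) - 1} \<Longrightarrow> (F', j) \<noteq> (F, i) \<Longrightarrow> x \<in> F' \<Longrightarrow>
      tn F' j (\<tau> x) = 0"
    "\<And>q. q \<in> mat_polys k T traceless_mats \<Longrightarrow> L2_inner lborel T \<tau> q = 0"
proof -
  obtain P where P: "P \<in> polys k UNIV" "Q = zero_ext F P" using Q polys_iff_extension by blast
  define \<sigma> where "\<sigma> = (\<lambda>x. zero_ext T P x *\<^sub>R dual_mat F i)"
  have "zero_ext T P \<in> polys k T" using P(1) polys_iff_extension by blast
  then have \<sigma>: "\<sigma> \<in> mat_polys k T traceless_mats"
    unfolding \<sigma>_def
    by (rule mat_polys_scale_poly) (use trace_dual_mat[OF F i] in \<open>simp add: traceless_mats_def\<close>)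
  obtain \<beta> where \<beta>: "\<beta> \<in> bubble_tn (k + 1) T"
    "\<And>q. q \<in> mat_polys k T traceless_mats \<Longrightarrow> L2_inner lborel T \<beta> q = L2_inner lborel T \<sigma> q"
    using ex_bubble_with_moments[OF \<sigma>, of k] by blast
  have moments: "L2_inner lborel T (\<sigma> - \<beta>) q = 0" if "q \<in> mat_polys k T traceless_mats" for q
    using L2_inner_diff_left[OF full_support_T, of \<sigma> \<beta> q] \<beta> that \<sigma>
      continuous_on_traceless_polys by (auto simp: bubble_tn_iff)
  have "\<sigma> - \<beta> \<in> Sigma_plus k T"
    unfolding Sigma_plus_def
    using \<sigma> \<beta>(1) subspace_neg[OF subspace_bubble_tn] by (intro CollectI exI[of _ \<sigma>] exI[of _ "- \<beta>"]) auto
  then have "\<sigma> - \<beta> \<in> Sigma_plus_sym k T"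
    using moments mat_polys_subset[OF skew_mats_traceless, of k T] by (auto simp: Sigma_plus_sym_def)
  moreover have tn: "tn F' j ((\<sigma> - \<beta>) x) = (if F' = F \<and> j = i then P x else 0)"
    if "F' facet_of T" "j \<in> {1..CARD('n) - 1}" "x \<in> F'" for F' j x
    using that \<beta>(1) facet_body(4)[OF that(1)] tn_dual_mat[OF F i that(1,2)]
    by (auto simp: tn_diff tn_scale \<sigma>_def bubble_tn_iff)
  moreover have "tn F i ((\<sigma> - \<beta>) x) = Q x" if "x \<in> F" for x
    using tn[OF F i that] P(2) that by simp
  ultimately show thesis
    using moments by (intro that[of "\<sigma> - \<beta>"]) auto
qed

text \<open>A bubble with the moments of \<open>Q\<close> is orthogonal to the skew fields because the symmetric field \<open>Q\<close>
  is.\<close>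

lemma ex_interior_dual:
  assumes Q: "Q \<in> mat_polys k T (sym_mats \<inter> traceless_mats)"
  obtains \<tau> where "\<tau> \<in> Sigma_plus_sym k T"
    "\<And>F j x. F facet_of T \<Longrightarrow> j \<in> {1..CARD('n) - 1} \<Longrightarrow> x \<in> F \<Longrightarrow> tn F j (\<tau> x) = 0"
    "\<And>q. q \<in> mat_polys k T traceless_mats \<Longrightarrow> L2_inner lborel T \<tau> q = L2_inner lborel T Q q"
proof -
  have Q': "Q \<in> mat_polys k T traceless_mats"
    using Q mat_polys_subset[of "sym_mats \<inter> traceless_mats" traceless_mats] by blast
  obtain \<beta> where \<beta>: "\<beta> \<in> bubble_tn (k + 1) T"
    "\<And>q. q \<in> mat_polys k T traceless_mats \<Longrightarrow> L2_inner lborel T \<beta> q = L2_inner lborel T Q q"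
    using ex_bubble_with_moments[OF Q', of k] by blast
  have "L2_inner lborel T \<beta> q = 0" if q: "q \<in> mat_polys k T skew_mats" for q
  proof -
    have "q \<in> mat_polys k T traceless_mats" using q mat_polys_subset[OF skew_mats_traceless] by blast
    then have "L2_inner lborel T \<beta> q = L2_inner lborel T Q q" by (rule \<beta>(2))
    also have "\<dots> = L2_inner lborel T 0 q"
    proof (rule L2_inner_cong)
      fix x
      have "Q x \<in> sym_mats" "q x \<in> skew_mats"
        using Q q mat_polys_iff[OF subspace_inter[OF subspace_sym_mats subspace_traceless_mats]]
          mat_polys_iff[OF subspace_skew_mats] by blast+
      then show "Q x \<bullet> q x = 0 x \<bullet> q x" by (simp add: inner_sym_skew)
    qed
    also have "\<dots> = 0" by (rule L2_inner_zero_left[OF full_support_T])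
    finally show ?thesis .
  qed
  moreover have "\<beta> \<in> Sigma_plus k T"
    unfolding Sigma_plus_def
    using \<beta>(1) subspace_0[OF subspace_mat_polys] by (intro CollectI exI[of _ 0] exI[of _ \<beta>]) auto
  ultimately have "\<beta> \<in> Sigma_plus_sym k T" by (simp add: Sigma_plus_sym_def)
  then show thesis using \<beta> by (intro that[of \<beta>]) (auto simp: bubble_tn_iff)
qed

lemma Sigma_plus_sym_eq_0:
  assumes \<tau>: "\<tau> \<in> Sigma_plus_sym k T"
    and facets: "\<And>F i q. F facet_of T \<Longrightarrow> i \<in> {1..CARD('n) - 1} \<Longrightarrow> q \<in> polys k F \<Longrightarrow>
      L2_inner (surface_measure F) F (\<lambda>x. tn F i (\<tau> x)) q = 0"
    and interior: "\<And>q. q \<in> mat_polys k T (sym_mats \<inter> traceless_mats) \<Longrightarrow> L2_inner lborel T \<tau> q = 0"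
  shows "\<tau> = 0"
proof -
  have \<tau>': "\<tau> \<in> Sigma_plus k T" "\<tau> \<in> mat_polys (Suc k) T traceless_mats"
    using \<tau> Sigma_plus_subset by (auto simp: Sigma_plus_sym_def)
  have cont: "continuous_on T \<tau>" using continuous_on_Sigma_plus[OF \<tau>'(1)] .
  have interior': "L2_inner lborel T \<tau> q = 0" if q: "q \<in> mat_polys k T traceless_mats" for q
  proof -
    obtain s a where sa: "s \<in> mat_polys k T (sym_mats \<inter> traceless_mats)" "a \<in> mat_polys k T skew_mats" "q = s + a"
      using mat_polys_traceless_split[OF q] by blast
    have "continuous_on T s"
      using continuous_on_mat_polys[OF subspace_inter[OF subspace_sym_mats subspace_traceless_mats] sa(1)] .
    moreover have "continuous_on T a" using continuous_on_mat_polys[OF subspace_skew_mats sa(2)] .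
    ultimately have "L2_inner lborel T \<tau> q = L2_inner lborel T \<tau> s + L2_inner lborel T \<tau> a"
      unfolding sa(3) by (intro L2_inner_add_right[OF full_support_T] cont)
    also have "\<dots> = 0" using interior[OF sa(1)] \<tau> sa(2) by (simp add: Sigma_plus_sym_def)
    finally show ?thesis .
  qed
  have trace0: "tn F i (\<tau> x) = 0" if F: "F facet_of T" and i: "i \<in> {1..CARD('n) - 1}" and x: "x \<in> F" for F i x
  proof -
    let ?f = "zero_ext F (\<lambda>x. tn F i (\<tau> x))"
    have f: "?f \<in> polys k F" using tn_trace_in_polys[OF \<tau>'(1) F i] .
    have "L2_inner (surface_measure F) F ?f ?f = L2_inner (surface_measure F) F (\<lambda>x. tn F i (\<tau> x)) ?f"
      by (rule L2_inner_cong) simp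
    also have "\<dots> = 0" by (rule facets[OF F i f])
    finally have "?f x = 0"
      by (rule L2_inner_self_eq_0[OF full_support_facet[OF F] continuous_on_polys[OF f] _ x])
    then show ?thesis using x by simp
  qed
  have tn0: "tn F i (\<tau> x) = 0" if F: "F facet_of T" and i: "i \<in> {1..CARD('n) - 1}" and x: "x \<in> T" for F i x
  proof -
    obtain r where r: "r \<in> polys k T" "\<forall>x\<in>T. tn F i (\<tau> x) = height F x * r x"
      using vanishing_trace_divisible[OF F tn_in_polys[OF \<tau>'(2)] trace0[OF F i]] by blast
    let ?q = "\<lambda>x. r x *\<^sub>R dyad (t F i) (normal F)"
    let ?h = "\<lambda>x. height F x * r x * r x"
    have "dyad (t F i) (normal F) \<in> traceless_mats"
      using normal_tangent[OF F i] by (simp add: traceless_mats_def trace_dyad inner_commute)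
    then have "?q \<in> mat_polys k T traceless_mats" by (intro mat_polys_scale_poly r(1))
    then have "L2_inner lborel T \<tau> ?q = 0" by (rule interior')
    moreover have "L2_inner lborel T \<tau> ?q = L2_inner lborel T (\<lambda>x. height F x * r x) r"
      by (rule L2_inner_cong) (simp add: inner_dyad r(2))
    ultimately have int: "(LINT x:T|lborel. ?h x) = 0" by (simp add: L2_inner_def)
    have "?h x = 0"
    proof (rule full_support_integral_eq_0[OF full_support_T _ _ int x])
      show "continuous_on T ?h"
        by (intro continuous_on_mult continuous_on_height F continuous_on_polys[OF r(1)])
      show "0 \<le> ?h x" if "x \<in> T" for x
        using height_nonneg[OF F that] by (simp add: mult.assoc)
    qed
    then show ?thesis using r(2) x by auto
  qed
  have "\<tau> x = 0" for x
  proof (cases "x \<in> T")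
    case True
    then show ?thesis using traceless_eq_0_if_tn_eq_0[OF trace_eq_0[OF \<tau>'(2)]] tn0 by blast
  next
    case False
    then show ?thesis using mat_polys_outside[OF subspace_traceless_mats \<tau>'(2)] by simp
  qed
  then show ?thesis by (simp add: fun_eq_iff)
qed

end

section \<open>Unisolvence\<close>

lemma is_basis_finite:
  assumes "is_basis V B" "finite S" "V = span S" shows "finite B"
  using assms independent_span_bound[OF assms(2), of B] span_superset[of B]
  by (auto simp: is_basis_def)

text \<open>For the combination \<open>Q\<close> of \<open>B\<close> with coefficients \<open>c\<close> the hypothesis says \<open>(Q, Q) = 0\<close>.
  As the elements of \<open>B\<close> vanish outside \<open>D\<close>, it follows that \<open>Q = 0\<close>.\<close>

lemma gram_kernel_trivial:
  fixes B :: "('a::euclidean_space \<Rightarrow> 'b::real_inner) set"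
  assumes M: "full_support M D" and B: "finite B" "independent B"
    and cont: "\<And>q. q \<in> B \<Longrightarrow> continuous_on D q" and out: "\<And>q x. q \<in> B \<Longrightarrow> x \<notin> D \<Longrightarrow> q x = 0"
    and zero: "(\<Sum>q\<in>B. c q * L2_inner M D (\<Sum>p\<in>B. c p *\<^sub>R p) q) = 0" and q: "q \<in> B"
  shows "c q = 0"
proof -
  define Q where "Q = (\<Sum>p\<in>B. c p *\<^sub>R p)"
  have Q: "Q x = (\<Sum>p\<in>B. c p *\<^sub>R p x)" for x by (simp add: Q_def sum_fun_apply scaleR_fun_def)
  have cont_c: "continuous_on D (c p *\<^sub>R p)" if "p \<in> B" for p
    using cont[OF that] by (simp add: scaleR_fun_def continuous_intros)
  have cont_Q: "continuous_on D Q"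
    unfolding Q[abs_def] using cont by (intro continuous_intros)
  have "L2_inner M D Q Q = (\<Sum>p\<in>B. L2_inner M D Q (c p *\<^sub>R p))"
    by (subst (2) Q_def) (rule L2_inner_sum_right[OF M cont_c cont_Q])
  also have "\<dots> = 0"
    using zero unfolding Q_def[symmetric] by (simp add: L2_inner_scale_right[OF M])
  finally have "L2_inner M D Q Q = 0" .
  then have "Q x = 0" for x
    using L2_inner_self_eq_0[OF M cont_Q] by (cases "x \<in> D") (simp_all add: Q out)
  then have "Q = 0" by (simp add: fun_eq_iff)
  then show ?thesis
    using independentD[OF B(2,1) order_refl _ q, of c] by (simp add: Q_def)
qed

theorem lemma2p2:
  fixes T :: "(real^'n) set"
    and k :: nat
    and t :: "(real^'n) set \<Rightarrow> nat \<Rightarrow> real^'n"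
    and BF :: "(real^'n) set \<Rightarrow> (real^'n \<Rightarrow> real) set"
    and BT :: "(real^'n \<Rightarrow> real^'n^'n) set"
  assumes "CARD('n) \<ge> 2" and "k \<ge> 1"
    and "int CARD('n) simplex T"
    and "\<And>F. F facet_of T \<Longrightarrow> orthonormal_tangent_basis F (t F)"
    and "\<And>F. F facet_of T \<Longrightarrow> is_basis (polys k F) (BF F)"
    and "is_basis (mat_polys k T (sym_mats \<inter> traceless_mats)) BT"
  shows "unisolvent (Sigma_plus_sym k T) (dof_index T BF BT) (dof_val T t)"
proof -
  interpret framed_simplex T t using assms by unfold_locales
  note sub_ST = subspace_inter[OF subspace_sym_mats subspace_traceless_mats]
  let ?ST = "mat_polys k T (sym_mats \<inter> traceless_mats)"
  let ?J = "{1..CARD('n) - 1}"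
  have BF: "independent (BF F)" "span (BF F) = polys k F" if "F facet_of T" for F
    using assms(5)[OF that] by (auto simp: is_basis_def)
  have BT: "independent BT" "span BT = ?ST" using assms(6) by (auto simp: is_basis_def)
  have fin_BF: "finite (BF F)" if "F facet_of T" for F
    using is_basis_finite[OF assms(5)[OF that]] polys_finite_span by blast
  have fin_BT: "finite BT"
    using is_basis_finite[OF assms(6)] mat_polys_finite_span[OF sub_ST] by blast
  have BF_cont: "continuous_on F q" if "F facet_of T" "q \<in> BF F" for F q
    using that BF(2) span_base continuous_on_polys by blast
  have BT_cont: "continuous_on T q" if "q \<in> BT" for q
    using that BT(2) span_base continuous_on_mat_polys[OF sub_ST] by blast
  have V_cont: "continuous_on T \<tau>" if "\<tau> \<in> Sigma_plus_sym k T" for \<tau>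
    using that continuous_on_Sigma_plus by (auto simp: Sigma_plus_sym_def)
  have tn_cont: "continuous_on F (\<lambda>x. tn F i (\<tau> x))"
    if "F facet_of T" "\<tau> \<in> Sigma_plus_sym k T" for F i \<tau>
  proof -
    have "continuous_on F \<tau>" using V_cont that facet_body(4) continuous_on_subset by blast
    then show ?thesis unfolding tn_eq_inner_dyad by (intro continuous_intros)
  qed
  have fin_I: "finite (dof_index T BF BT)"
  proof -
    have "{Facet_dof F i q |F i q. F facet_of T \<and> i \<in> ?J \<and> q \<in> BF F}
        = (\<Union>F\<in>{F. F facet_of T}. \<Union>i\<in>?J. Facet_dof F i ` BF F)"
      by blast
    moreover have "{Interior_dof q |q. q \<in> BT} = Interior_dof ` BT" by auto
    ultimately show ?thesis
      unfolding dof_index_def using finite_facets fin_BF fin_BT by simp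
  qed
  have BT_traceless: "q \<in> mat_polys k T traceless_mats" if "q \<in> BT" for q
    using that BT(2) span_base mat_polys_subset[of "sym_mats \<inter> traceless_mats" traceless_mats k T] by blast
  obtain S where S: "finite S" "mat_polys (k + 1) T traceless_mats = span S"
    using mat_polys_finite_span[OF subspace_traceless_mats] by blast
  show ?thesis
  proof (rule unisolventI)
    show "subspace (Sigma_plus_sym k T)" by (rule subspace_Sigma_plus_sym)
    show "finite S" by (rule S(1))
    show "Sigma_plus_sym k T \<subseteq> span S"
      using Sigma_plus_subset[of k] S(2) by (auto simp: Sigma_plus_sym_def)
    show "finite (dof_index T BF BT)" by (rule fin_I)
  next
    fix i \<sigma> \<tau> assume i: "i \<in> dof_index T BF BT"
      and V: "\<sigma> \<in> Sigma_plus_sym k T" "\<tau> \<in> Sigma_plus_sym k T"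
    show "dof_val T t i (\<sigma> + \<tau>) = dof_val T t i \<sigma> + dof_val T t i \<tau>"
      using i unfolding dof_index_def
    proof (elim UnE CollectE exE conjE)
      fix F j q assume F: "i = Facet_dof F j q" "F facet_of T" "q \<in> BF F"
      have "(\<lambda>x. tn F j ((\<sigma> + \<tau>) x)) = (\<lambda>x. tn F j (\<sigma> x)) + (\<lambda>x. tn F j (\<tau> x))"
        by (simp add: fun_eq_iff tn_add)
      then show ?thesis
        using L2_inner_add_left[OF full_support_facet[OF F(2)] tn_cont tn_cont BF_cont] F V by simp
    next
      fix q assume "i = Interior_dof q" "q \<in> BT"
      then show ?thesis
        using L2_inner_add_left[OF full_support_T V_cont V_cont BT_cont] V by simp
    qed
  next
    fix i c \<tau> assume "i \<in> dof_index T BF BT"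
    show "dof_val T t i (c *\<^sub>R \<tau>) = c * dof_val T t i \<tau>"
    proof (cases i)
      case (Facet_dof F j q)
      have "(\<lambda>x. tn F j ((c *\<^sub>R \<tau>) x)) = c *\<^sub>R (\<lambda>x. tn F j (\<tau> x))"
        by (simp add: fun_eq_iff tn_scale scaleR_fun_def)
      then show ?thesis using Facet_dof by (simp add: L2_inner_def scaleR_fun_def mult.assoc)
    next
      case (Interior_dof q)
      then show ?thesis by (simp add: L2_inner_scale_left[OF full_support_T])
    qed
  next
    fix \<tau> assume \<tau>: "\<tau> \<in> Sigma_plus_sym k T"
      and zero: "\<And>i. i \<in> dof_index T BF BT \<Longrightarrow> dof_val T t i \<tau> = 0"
    show "\<tau> = 0"
    proof (rule Sigma_plus_sym_eq_0[OF \<tau>])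
      fix F i q assume F: "F facet_of T" and i: "i \<in> ?J" and q: "q \<in> polys k F"
      have "L2_inner (surface_measure F) F (\<lambda>x. tn F i (\<tau> x)) p = 0" if "p \<in> BF F" for p
        using zero[of "Facet_dof F i p"] that F i by (auto simp: dof_index_def)
      then show "L2_inner (surface_measure F) F (\<lambda>x. tn F i (\<tau> x)) q = 0"
        using BF_cont[OF F] q BF(2)[OF F]
        by (intro L2_inner_zero_on_span[OF full_support_facet[OF F] tn_cont[OF F \<tau>], of "BF F"]) auto
    next
      fix q assume q: "q \<in> ?ST"
      have "L2_inner lborel T \<tau> p = 0" if "p \<in> BT" for p
        using zero[of "Interior_dof p"] that by (auto simp: dof_index_def)
      then show "L2_inner lborel T \<tau> q = 0"
        using BT_cont q BT(2)
        by (intro L2_inner_zero_on_span[OF full_support_T V_cont[OF \<tau>], of BT]) auto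
    qed
  next
    fix c i assume comb: "\<And>\<tau>. \<tau> \<in> Sigma_plus_sym k T \<Longrightarrow> (\<Sum>i\<in>dof_index T BF BT. c i * dof_val T t i \<tau>) = 0"
      and i: "i \<in> dof_index T BF BT"
    show "c i = 0"
      using i unfolding dof_index_def
    proof (elim UnE CollectE exE conjE)
      fix F j q assume F: "i = Facet_dof F j q" "F facet_of T" "j \<in> ?J" "q \<in> BF F"
      \<comment> \<open>Testing with a field whose only nonzero trace is the combination \<open>Q\<close> of the basis functions
        on \<open>F\<close> leaves \<open>(Q, Q)\<^sub>F = 0\<close> of the vanishing combination of functionals.\<close>
      define Q where "Q = (\<Sum>p\<in>BF F. c (Facet_dof F j p) *\<^sub>R p)"
      have Q: "Q \<in> polys k F"
        unfolding Q_def BF(2)[OF F(2), symmetric] by (intro span_sum span_scale span_base)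
      obtain \<tau> where \<tau>: "\<tau> \<in> Sigma_plus_sym k T" "\<And>x. x \<in> F \<Longrightarrow> tn F j (\<tau> x) = Q x"
        "\<And>F' j' x. F' facet_of T \<Longrightarrow> j' \<in> ?J \<Longrightarrow> (F', j') \<noteq> (F, j) \<Longrightarrow> x \<in> F' \<Longrightarrow> tn F' j' (\<tau> x) = 0"
        "\<And>q. q \<in> mat_polys k T traceless_mats \<Longrightarrow> L2_inner lborel T \<tau> q = 0"
      proof (rule ex_facet_dual[OF F(2,3) Q], goal_cases)
        case (1 \<tau>)
        from 1(2-5) show ?thesis by (rule that)
      qed
      have other: "dof_val T t z \<tau> = 0" if z: "z \<in> dof_index T BF BT - Facet_dof F j ` BF F" for z
      proof (cases z)
        case (Facet_dof F' j' p)
        then have F': "F' facet_of T" "j' \<in> ?J" "(F', j') \<noteq> (F, j)"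
          using z by (auto simp: dof_index_def)
        have "dof_val T t z \<tau> = L2_inner (surface_measure F') F' 0 p"
          unfolding Facet_dof dof_val.simps using \<tau>(3)[OF F'] by (intro L2_inner_cong) simp
        then show ?thesis by (simp add: L2_inner_zero_left[OF full_support_facet[OF F'(1)]])
      next
        case (Interior_dof p)
        then have "p \<in> BT" using z by (auto simp: dof_index_def)
        then show ?thesis using Interior_dof \<tau>(4) BT_traceless by simp
      qed
      have "0 = (\<Sum>i\<in>dof_index T BF BT. c i * dof_val T t i \<tau>)" using comb[OF \<tau>(1)] by simp
      also have "\<dots> = (\<Sum>i\<in>Facet_dof F j ` BF F. c i * dof_val T t i \<tau>)"
      proof (rule sum.mono_neutral_right[OF fin_I])
        show "Facet_dof F j ` BF F \<subseteq> dof_index T BF BT"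
          using F(2,3) unfolding dof_index_def by blast
      qed (use other in simp)
      also have "\<dots> = (\<Sum>p\<in>BF F. c (Facet_dof F j p) * L2_inner (surface_measure F) F (\<lambda>x. tn F j (\<tau> x)) p)"
        by (subst sum.reindex) (auto intro: inj_onI)
      also have "\<dots> = (\<Sum>p\<in>BF F. c (Facet_dof F j p) * L2_inner (surface_measure F) F Q p)"
        by (intro sum.cong refl arg_cong[where f = "(*) _"] L2_inner_cong) (simp add: \<tau>(2))
      finally have zero: "(\<Sum>p\<in>BF F. c (Facet_dof F j p) * L2_inner (surface_measure F) F Q p) = 0"
        by (rule sym)
      have out: "p x = 0" if "p \<in> BF F" "x \<notin> F" for p x
        using polys_outside[of p k F x] that BF(2)[OF F(2)] span_base by blast
      show "c i = 0"
        unfolding F(1)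
      proof (rule gram_kernel_trivial[where c = "\<lambda>p. c (Facet_dof F j p)",
            OF full_support_facet[OF F(2)] fin_BF[OF F(2)] BF(1)[OF F(2)] _ _ zero[unfolded Q_def] F(4)])
        show "continuous_on F p" if "p \<in> BF F" for p using BF_cont[OF F(2) that] .
        show "p x = 0" if "p \<in> BF F" "x \<notin> F" for p x using out[OF that] .
      qed
    next
      fix q assume q: "i = Interior_dof q" "q \<in> BT"
      \<comment> \<open>Likewise, a bubble with the moments of \<open>Q\<close> leaves \<open>(Q, Q)\<^sub>T = 0\<close>.\<close>
      define Q where "Q = (\<Sum>p\<in>BT. c (Interior_dof p) *\<^sub>R p)"
      have Q: "Q \<in> ?ST"
        unfolding Q_def BT(2)[symmetric] by (intro span_sum span_scale span_base)
      obtain \<tau> where \<tau>: "\<tau> \<in> Sigma_plus_sym k T"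
        "\<And>F j x. F facet_of T \<Longrightarrow> j \<in> ?J \<Longrightarrow> x \<in> F \<Longrightarrow> tn F j (\<tau> x) = 0"
        "\<And>q. q \<in> mat_polys k T traceless_mats \<Longrightarrow> L2_inner lborel T \<tau> q = L2_inner lborel T Q q"
      proof (rule ex_interior_dual[OF Q], goal_cases)
        case (1 \<tau>)
        from 1(2-4) show ?thesis by (rule that)
      qed
      have other: "dof_val T t z \<tau> = 0" if z: "z \<in> dof_index T BF BT - Interior_dof ` BT" for z
      proof (cases z)
        case (Facet_dof F j p)
        then have F: "F facet_of T" "j \<in> ?J" using z by (auto simp: dof_index_def)
        have "dof_val T t z \<tau> = L2_inner (surface_measure F) F 0 p"
          unfolding Facet_dof dof_val.simps using \<tau>(2)[OF F] by (intro L2_inner_cong) simp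
        then show ?thesis by (simp add: L2_inner_zero_left[OF full_support_facet[OF F(1)]])
      next
        case (Interior_dof p)
        then show ?thesis using z by (auto simp: dof_index_def)
      qed
      have "0 = (\<Sum>i\<in>dof_index T BF BT. c i * dof_val T t i \<tau>)" using comb[OF \<tau>(1)] by simp
      also have "\<dots> = (\<Sum>i\<in>Interior_dof ` BT. c i * dof_val T t i \<tau>)"
        by (rule sum.mono_neutral_right[OF fin_I]) (use other in \<open>auto simp: dof_index_def\<close>)
      also have "\<dots> = (\<Sum>p\<in>BT. c (Interior_dof p) * L2_inner lborel T \<tau> p)"
        by (subst sum.reindex) (auto intro: inj_onI)
      also have "\<dots> = (\<Sum>p\<in>BT. c (Interior_dof p) * L2_inner lborel T Q p)"
        by (intro sum.cong refl) (simp add: \<tau>(3) BT_traceless)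
      finally have zero: "(\<Sum>p\<in>BT. c (Interior_dof p) * L2_inner lborel T Q p) = 0"
        by (rule sym)
      have out: "p x = 0" if "p \<in> BT" "x \<notin> T" for p x
        using mat_polys_outside[OF subspace_traceless_mats BT_traceless] that by blast
      show "c i = 0"
        unfolding q(1)
      proof (rule gram_kernel_trivial[where c = "\<lambda>p. c (Interior_dof p)",
            OF full_support_T fin_BT BT(1) _ _ zero[unfolded Q_def] q(2)])
        show "continuous_on T p" if "p \<in> BT" for p using BT_cont[OF that] .
        show "p x = 0" if "p \<in> BT" "x \<notin> T" for p x using out[OF that] .
      qed
    qed
  qed
qed

end
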